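(* Let $K$ be an algebraically closed field of characteristic $0$. If $f \in K\langle x,y,z\rangle$ is a multilinear polynomial of degree three, then for every $n \in \mathbb{N}$ the image $f(M_n(K)) = \{ f(a,b,c) \mid a,b,c \in M_n(K)\}$ is a vector space, i.e. a $K$-linear subspace of $M_n(K)$.
   Context: $K\langle x,y,z\rangle$ denotes the free associative algebra over $K$ in the noncommuting variables $x,y,z$. A multilinear polynomial of degree three in $K\langle x,y,z\rangle$ is one of the form $f(x,y,z) = \lambda_1 xyz + \lambda_2 yzx + \lambda_3 zxy + \mu_1 zyx + \mu_2 xzy + \mu_3 yxz$ with $\lambda_i,\mu_i\in K$. $M_n(K)$ is the algebra of $n\times n$ matrices over $K$, and $\mathbb{N}$ is the set of positive integers. *)

theory Defs
  imports "Jordan_Normal_Form.VS_Connect" "HOL-Library.Poly_Mapping"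
begin

text \<open>
  The free algebra \<open>K\<langle>x,y,z\<rangle>\<close> is the monoid algebra over \<open>K\<close> of the free monoid on three letters.
  The ring structure of \<^typ>\<open>'m \<Rightarrow>\<^sub>0 'k\<close> is convolution with respect to an additively written
  monoid \<open>'m\<close>, so concatenation of words is written \<open>+\<close> and the empty word \<open>0\<close>.
\<close>

datatype 'v free_monoid = FM (letters: "'v list")

instantiation free_monoid :: (type) monoid_add
begin

definition zero_free_monoid :: "'a free_monoid" where
  "zero_free_monoid = FM []"

definition plus_free_monoid :: "'a free_monoid \<Rightarrow> 'a free_monoid \<Rightarrow> 'a free_monoid" where
  "plus_free_monoid u v = FM (letters u @ letters v)"

instance
  by standard (simp_all add: zero_free_monoid_def plus_free_monoid_def)

end

datatype indet = Ind_x | Ind_y | Ind_z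

type_synonym 'k nc_poly = "indet free_monoid \<Rightarrow>\<^sub>0 'k"

definition nc_const :: "'k \<Rightarrow> 'k::comm_ring_1 nc_poly" where
  "nc_const c = Poly_Mapping.single 0 c"

definition nc_var :: "indet \<Rightarrow> 'k::comm_ring_1 nc_poly" where
  "nc_var v = Poly_Mapping.single (FM [v]) 1"

definition multilinear_deg3 :: "'k::comm_ring_1 nc_poly \<Rightarrow> bool" where
  "multilinear_deg3 f \<longleftrightarrow>
     (let x = nc_var Ind_x; y = nc_var Ind_y; z = nc_var Ind_z in
      \<exists>l1 l2 l3 m1 m2 m3.
        f = nc_const l1 * (x * y * z) + nc_const l2 * (y * z * x) + nc_const l3 * (z * x * y)
          + nc_const m1 * (z * y * x) + nc_const m2 * (x * z * y) + nc_const m3 * (y * x * z))"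

definition word_eval :: "nat \<Rightarrow> (indet \<Rightarrow> 'k::comm_ring_1 mat) \<Rightarrow> indet free_monoid \<Rightarrow> 'k mat" where
  "word_eval n s w = foldr (\<lambda>v A. s v * A) (letters w) (1\<^sub>m n)"

text \<open>
  \<^typ>\<open>'k mat\<close> contains matrices of all sizes and has no zero valid for every size, so the finite
  linear combination of matrices is formed entrywise.
\<close>

definition nc_eval :: "nat \<Rightarrow> (indet \<Rightarrow> 'k::comm_ring_1 mat) \<Rightarrow> 'k nc_poly \<Rightarrow> 'k mat" where
  "nc_eval n s f = mat n n (\<lambda>(i, j).
     \<Sum>w\<in>Poly_Mapping.keys f. Poly_Mapping.lookup f w * word_eval n s w $$ (i, j))"

definition nc_subst :: "'k mat \<Rightarrow> 'k mat \<Rightarrow> 'k mat \<Rightarrow> indet \<Rightarrow> 'k mat" where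
  "nc_subst a b c v = (case v of Ind_x \<Rightarrow> a | Ind_y \<Rightarrow> b | Ind_z \<Rightarrow> c)"

definition nc_image :: "nat \<Rightarrow> 'k::comm_ring_1 nc_poly \<Rightarrow> 'k mat set" where
  "nc_image n f =
     {nc_eval n (nc_subst a b c) f | a b c.
        a \<in> carrier_mat n n \<and> b \<in> carrier_mat n n \<and> c \<in> carrier_mat n n}"


text \<open>
  Evaluation at square matrices of one fixed size is a unital algebra homomorphism sending the
  variables to the given matrices.
\<close>

lemma word_eval_carrier:
  assumes "\<And>v. s v \<in> carrier_mat n n"
  shows "word_eval n s w \<in> carrier_mat n n"
proof -
  have "foldr (\<lambda>v A. s v * A) vs (1\<^sub>m n) \<in> carrier_mat n n" for vs
    by (induction vs) (auto intro: mult_carrier_mat assms)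
  then show ?thesis by (simp add: word_eval_def)
qed

lemma word_eval_plus:
  assumes s: "\<And>v. s v \<in> carrier_mat n n"
  shows "word_eval n s (u + w) = word_eval n s u * word_eval n s w"
proof -
  have c: "foldr (\<lambda>v A. s v * A) vs (1\<^sub>m n) \<in> carrier_mat n n" for vs
    using word_eval_carrier[of s n "FM vs"] s by (simp add: word_eval_def)
  have "foldr (\<lambda>v A. s v * A) (us @ ws) (1\<^sub>m n) =
        foldr (\<lambda>v A. s v * A) us (1\<^sub>m n) * foldr (\<lambda>v A. s v * A) ws (1\<^sub>m n)" for us ws
  proof (induction us)
    case Nil
    then show ?case using left_mult_one_mat[OF c] by simp
  next
    case (Cons v us)
    then show ?case using assoc_mult_mat[OF s c c] by simp
  qed
  then show ?thesis by (simp add: word_eval_def plus_free_monoid_def)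
qed

lemma nc_eval_carrier [simp]: "nc_eval n s f \<in> carrier_mat n n"
  by (simp add: nc_eval_def)

lemma nc_eval_dim [simp]: "dim_row (nc_eval n s f) = n" "dim_col (nc_eval n s f) = n"
  by (simp_all add: nc_eval_def)

lemma nc_eval_index:
  assumes "i < n" "j < n" "finite W" "Poly_Mapping.keys f \<subseteq> W"
  shows "nc_eval n s f $$ (i, j) = (\<Sum>w\<in>W. Poly_Mapping.lookup f w * word_eval n s w $$ (i, j))"
  using assms
  by (auto simp: nc_eval_def in_keys_iff intro!: sum.mono_neutral_left)

lemma nc_eval_add: "nc_eval n s (f + g) = nc_eval n s f + nc_eval n s g"
proof (rule eq_matI)
  fix i j assume ij: "i < dim_row (nc_eval n s f + nc_eval n s g)"
    "j < dim_col (nc_eval n s f + nc_eval n s g)"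
  let ?W = "Poly_Mapping.keys f \<union> Poly_Mapping.keys g"
  show "nc_eval n s (f + g) $$ (i, j) = (nc_eval n s f + nc_eval n s g) $$ (i, j)"
    using ij Poly_Mapping.keys_add[of f g]
    by (simp add: nc_eval_index[of _ _ _ ?W] lookup_add distrib_right sum.distrib)
qed auto

lemma nc_eval_single:
  assumes "\<And>v. s v \<in> carrier_mat n n"
  shows "nc_eval n s (Poly_Mapping.single w c) = c \<cdot>\<^sub>m word_eval n s w"
  using word_eval_carrier[of s n w, OF assms]
  by (intro eq_matI) (auto simp: nc_eval_index[of _ _ _ "{w}"])

lemma nc_eval_zero: "nc_eval n s 0 = 0\<^sub>m n n"
  by (auto simp: nc_eval_def)

lemma nc_poly_induct [case_names zero add]:
  fixes f :: "'k::comm_ring_1 nc_poly"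
  assumes "P 0" and "\<And>w c f. P f \<Longrightarrow> P (Poly_Mapping.single w c + f)"
  shows "P f"
proof (induction f rule: update_induct)
  case const
  then show ?case by (rule assms(1))
next
  case (update f w c)
  have "Poly_Mapping.update w c f = Poly_Mapping.single w c + f"
    using update(1)
    by (intro poly_mapping_eqI) (auto simp: lookup_update lookup_add lookup_single in_keys_iff)
  with assms(2)[OF update(3)] show ?case by simp
qed

lemma nc_eval_mult:
  assumes s: "\<And>v. s v \<in> carrier_mat n n"
  shows "nc_eval n s (f * g) = nc_eval n s f * nc_eval n s g"
proof -
  have monomials: "nc_eval n s (Poly_Mapping.single u a * Poly_Mapping.single w b) =
      nc_eval n s (Poly_Mapping.single u a) * nc_eval n s (Poly_Mapping.single w b)" for u a w b
  proof -
    have c: "word_eval n s v \<in> carrier_mat n n" for v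
      by (rule word_eval_carrier[of s n, OF s])
    have "nc_eval n s (Poly_Mapping.single u a * Poly_Mapping.single w b) =
        (a * b) \<cdot>\<^sub>m (word_eval n s u * word_eval n s w)"
      by (simp add: mult_single nc_eval_single[OF s] word_eval_plus[OF s])
    also have "\<dots> = (a \<cdot>\<^sub>m word_eval n s u) * (b \<cdot>\<^sub>m word_eval n s w)"
      using c[of u] c[of w]
      by (auto intro!: eq_matI simp: ac_simps)
    finally show ?thesis by (simp add: nc_eval_single[OF s])
  qed
  have single: "nc_eval n s (Poly_Mapping.single u a * g) =
      nc_eval n s (Poly_Mapping.single u a) * nc_eval n s g" for u a
  proof (induction g rule: nc_poly_induct)
    case zero
    show ?case using right_mult_zero_mat[of "nc_eval n s (Poly_Mapping.single u a)" n n n]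
      by (simp add: nc_eval_zero)
  next
    case (add w b g)
    then show ?case
      by (simp add: distrib_left nc_eval_add monomials
          mult_add_distrib_mat[OF nc_eval_carrier nc_eval_carrier nc_eval_carrier])
  qed
  show ?thesis
  proof (induction f rule: nc_poly_induct)
    case zero
    show ?case using left_mult_zero_mat[of "nc_eval n s g" n n n] by (simp add: nc_eval_zero)
  next
    case (add u a f)
    then show ?case
      by (simp add: distrib_right nc_eval_add single
          add_mult_distrib_mat[OF nc_eval_carrier nc_eval_carrier nc_eval_carrier])
  qed
qed

lemma nc_eval_const:
  assumes "\<And>v. s v \<in> carrier_mat n n"
  shows "nc_eval n s (nc_const c) = c \<cdot>\<^sub>m 1\<^sub>m n"
  using nc_eval_single[of s n 0 c, OF assms]
  by (simp add: nc_const_def word_eval_def zero_free_monoid_def)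

lemma nc_eval_var:
  assumes "\<And>v. s v \<in> carrier_mat n n"
  shows "nc_eval n s (nc_var v) = s v"
  using nc_eval_single[of s n "FM [v]" 1, OF assms] right_mult_one_mat[OF assms[of v]]
  by (auto simp: nc_var_def word_eval_def intro!: eq_matI)

text \<open>
  \<^const>\<open>class_ring\<close> is the field \<open>K\<close> and \<^const>\<open>module_mat\<close> the space \<open>M\<^sub>n(K)\<close>; a subspace in the
  sense of the locale is a nonempty subset closed under addition and scalar multiplication.
\<close>

lemma vectorspace_module_mat: "vectorspace class_ring (module_mat TYPE('k::field) n m)"
proof -
  interpret abelian_group "module_mat TYPE('k) n m" by (rule abelian_group_mat)
  interpret field "class_ring :: 'k ring" by (rule class_field)
  show ?thesis
    by unfold_locales
      (auto simp: class_ring_simps module_mat_simps algebra_simps intro!: eq_matI)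
qed

lemma subspace_module_mat_iff:
  "VectorSpace.subspace class_ring W (module_mat TYPE('k::field) n m) \<longleftrightarrow>
     W \<subseteq> carrier_mat n m \<and> 0\<^sub>m n m \<in> W \<and> (\<forall>A\<in>W. \<forall>B\<in>W. A + B \<in> W) \<and> (\<forall>c. \<forall>A\<in>W. c \<cdot>\<^sub>m A \<in> W)"
  using vectorspace_module_mat[where 'k='k, of n m]
  by (auto simp: VectorSpace.subspace_def LinearCombinations.submodule_def vectorspace_def
      class_ring_simps module_mat_simps)

end

theory Submission
  imports Defs
begin

text \<open>
  If the coefficients of \<open>f\<close> do not sum to zero, then \<open>f(a, 1, 1)\<close> is a nonzero multiple of \<open>a\<close> and the
  image is \<open>M\<^sub>n(K)\<close>. Otherwise \<open>f(a, b, 1) = \<alpha> [a, b]\<close> and likewise for the other two variables. If all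
  three constants vanish, then \<open>f\<close> is a Lie polynomial, \<open>f(a, b, a)\<close> is a multiple of \<open>[a, [a, b]]\<close>, and the
  image is \<open>0\<close> or the space \<open>sl\<^sub>n\<close> of traceless matrices, since each of these is similar to a matrix with
  zero diagonal (Fillmore). Suppose, after a cyclic rotation of the variables, that \<open>\<alpha> \<noteq> 0\<close>. Then the
  image contains \<open>sl\<^sub>n\<close>, and equals it if the coefficients of \<open>xyz\<close>, \<open>yzx\<close>, \<open>zxy\<close> sum to zero. If they do
  not and \<open>n \<ge> 2\<close>, every matrix is attained: for a nonscalar matrix of nonzero trace, bring its diagonal
  to a suitable form with two nonzero entries and solve for \<open>b\<close> with \<open>a\<close> diagonal and \<open>c\<close> a scalar plus a
  matrix unit; for a scalar matrix, take \<open>a\<close> and \<open>b\<close> opposite weighted shifts and \<open>c\<close> diagonal.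
\<close>

section \<open>Similarity to matrices with prescribed diagonal\<close>

definition mat_trace :: "'a::comm_ring_1 mat \<Rightarrow> 'a" where
  "mat_trace A = (\<Sum>i<dim_row A. A $$ (i, i))"

text \<open>For square matrices this negates being a multiple of the identity. The entrywise form
  supplies two distinct indices, so the size is at least 2.\<close>

definition nonscalar :: "'a::zero mat \<Rightarrow> bool" where
  "nonscalar A \<longleftrightarrow> (\<exists>i<dim_row A. \<exists>j<dim_row A. i \<noteq> j \<and> (A $$ (i, j) \<noteq> 0 \<or> A $$ (i, i) \<noteq> A $$ (j, j)))"

lemma index_mult_mat_sum:
  assumes "A \<in> carrier_mat n m" "B \<in> carrier_mat m p" "i < n" "j < p"
  shows "(A * B) $$ (i, j) = (\<Sum>k<m. A $$ (i, k) * B $$ (k, j))"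
  using assms by (auto simp: scalar_prod_def atLeast0LessThan intro!: sum.cong)

lemma mat_trace_mult_comm:
  assumes A: "A \<in> carrier_mat n m" and B: "B \<in> carrier_mat m n"
  shows "mat_trace (A * B) = mat_trace (B * A)"
proof -
  have "mat_trace (A * B) = (\<Sum>i<n. \<Sum>k<m. A $$ (i, k) * B $$ (k, i))"
    using A B by (simp add: mat_trace_def index_mult_mat_sum[OF A B] del: index_mult_mat(1))
  also have "\<dots> = (\<Sum>k<m. \<Sum>i<n. B $$ (k, i) * A $$ (i, k))"
    by (subst sum.swap) (simp add: mult.commute)
  also have "\<dots> = mat_trace (B * A)"
    using A B by (simp add: mat_trace_def index_mult_mat_sum[OF B A] del: index_mult_mat(1))
  finally show ?thesis .
qed

lemma mat_trace_similar:
  assumes A: "A \<in> carrier_mat n n" and sim: "similar_mat_wit A B P Q"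
  shows "mat_trace A = mat_trace B"
proof -
  note D = similar_mat_witD2[OF A sim]
  have "mat_trace A = mat_trace (P * (B * Q))" unfolding D(3) using D(5,6,7) by (subst assoc_mult_mat) auto
  also have "\<dots> = mat_trace (B * Q * P)" using D(5,6,7) by (intro mat_trace_mult_comm) auto
  also have "B * Q * P = B" using D(2,5,6,7) by (subst assoc_mult_mat) auto
  finally show ?thesis .
qed

lemma mat_trace_four_block:
  assumes "A \<in> carrier_mat n n" "D \<in> carrier_mat m m"
  shows "mat_trace (four_block_mat A B C D) = mat_trace A + mat_trace D"
proof -
  have "mat_trace (four_block_mat A B C D) = (\<Sum>i<n + m. if i < n then A $$ (i, i) else D $$ (i - n, i - n))"
    using assms by (auto simp: mat_trace_def intro!: sum.cong)
  also have "\<dots> = (\<Sum>i<n. A $$ (i, i)) + (\<Sum>i<m. D $$ (i, i))"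
    by (induction m) (auto simp: add.assoc)
  also have "\<dots> = mat_trace A + mat_trace D" using assms by (simp add: mat_trace_def)
  finally show ?thesis .
qed

lemma nonscalar_transpose:
  assumes "A \<in> carrier_mat n n" "nonscalar A" shows "nonscalar (transpose_mat A)"
proof -
  from assms obtain i j where "i < n" "j < n" "i \<noteq> j" "A $$ (i, j) \<noteq> 0 \<or> A $$ (i, i) \<noteq> A $$ (j, j)"
    by (auto simp: nonscalar_def)
  then show ?thesis
    using assms(1) unfolding nonscalar_def
    by - (rule exI[of _ j], rule conjI, simp, rule exI[of _ i], auto)
qed

text \<open>
  The minors of \<open>(v, A v)\<close> are quadratic in \<open>v\<close>, so by the parallelogram law they cannot all vanish
  on the complement of the hyperplane \<open>\<psi> = 0\<close>.
\<close>
lemma nonscalar_noneigenvector: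
  fixes A :: "'a::field_char_0 mat"
  assumes A: "A \<in> carrier_mat n n" "nonscalar A" and k: "k < n" "\<psi> k \<noteq> 0"
  obtains v i j where "i < n" "j < n" "(\<Sum>k<n. \<psi> k * v k) \<noteq> 0"
    "v i * (\<Sum>k<n. A $$ (j, k) * v k) \<noteq> v j * (\<Sum>k<n. A $$ (i, k) * v k)"
proof -
  define av where "av v i = (\<Sum>k<n. A $$ (i, k) * v k)" for v :: "nat \<Rightarrow> 'a" and i
  define p where "p v = (\<Sum>k<n. \<psi> k * v k)" for v :: "nat \<Rightarrow> 'a"
  define m where "m v i j = v i * av v j - v j * av v i" for v :: "nat \<Rightarrow> 'a" and i j
  have av: "av (\<lambda>i. v i + w i) i = av v i + av w i" "av (\<lambda>i. v i - w i) i = av v i - av w i" for v w i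
    by (simp_all add: av_def algebra_simps sum.distrib sum_subtractf)
  have p: "p (\<lambda>i. v i + w i) = p v + p w" "p (\<lambda>i. v i - w i) = p v - p w" for v w
    by (simp_all add: p_def algebra_simps sum.distrib sum_subtractf)
  have par: "m (\<lambda>i. v i + w i) i j + m (\<lambda>i. v i - w i) i j = 2 * m v i j + 2 * m w i j" for v w i j
    by (simp add: m_def av algebra_simps)
  have av_unit: "av (\<lambda>k. if k = l then c else 0) i = A $$ (i, l) * c" if "l < n" for l c i
    using that by (simp add: av_def if_distrib sum.delta cong: if_cong)
  \<comment> \<open>The minor at \<open>(i, j)\<close> is \<open>- A $$ (i, j)\<close> for the unit
    vector at j and \<open>A $$ (j, i)\<close> for the one at i. If both vanish, their sum gives
    \<open>A $$ (j, j) - A $$ (i, i)\<close>.\<close>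
  obtain v1 i j where v1: "i < n" "j < n" "m v1 i j \<noteq> 0"
  proof -
    from A obtain i j where ij: "i < n" "j < n" "i \<noteq> j" "A $$ (i, j) \<noteq> 0 \<or> A $$ (i, i) \<noteq> A $$ (j, j)"
      by (auto simp: nonscalar_def)
    let ?e = "\<lambda>l k. if k = l then 1 else 0 :: 'a"
    consider "A $$ (i, j) \<noteq> 0" | "A $$ (j, i) \<noteq> 0" | "A $$ (i, j) = 0" "A $$ (j, i) = 0" "A $$ (i, i) \<noteq> A $$ (j, j)"
      using ij by blast
    then show ?thesis
    proof cases
      case 1
      have "m (?e j) i j \<noteq> 0" using ij 1 by (simp add: m_def av_unit)
      then show ?thesis using that ij by blast
    next
      case 2
      have "m (?e i) i j \<noteq> 0" using ij 2 by (simp add: m_def av_unit)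
      then show ?thesis using that ij by blast
    next
      case 3
      have "m (\<lambda>k. ?e i k + ?e j k) i j \<noteq> 0" using ij 3 by (simp add: m_def av_unit av)
      then show ?thesis using that ij by blast
    qed
  qed
  define v0 where "v0 l = (if l = k then 1 else 0 :: 'a)" for l
  have v0: "p v0 \<noteq> 0"
    using k by (simp add: p_def v0_def if_distrib sum.delta cong: if_cong)
  \<comment> \<open>If \<open>p v1 = 0\<close>, then \<open>p\<close> takes the same nonzero value
    at \<open>v0\<close>, \<open>v0 + v1\<close> and \<open>v0 - v1\<close>, and \<open>par\<close>
    forces a nonzero minor at one of them since 2 is nonzero.\<close>
  obtain v where "p v \<noteq> 0" "m v i j \<noteq> 0"
  proof (cases "p v1 = 0")
    case True
    then have "p v0 \<noteq> 0" "p (\<lambda>i. v0 i + v1 i) \<noteq> 0" "p (\<lambda>i. v0 i - v1 i) \<noteq> 0"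
      using v0 by (simp_all add: p)
    moreover have "m v0 i j \<noteq> 0 \<or> m (\<lambda>i. v0 i + v1 i) i j \<noteq> 0 \<or> m (\<lambda>i. v0 i - v1 i) i j \<noteq> 0"
      using par[of v0 v1 i j] v1 by auto
    ultimately show ?thesis using that by blast
  qed (use v1 that in blast)
  then show ?thesis using that[of i j v] v1(1,2) by (simp add: p_def m_def av_def)
qed

text \<open>Completes v to a basis with all unit vectors except the k-th; the transposition of 0 and
  k lists them in columns 1 to n - 1.\<close>

lemma invertible_with_first_column:
  fixes v :: "nat \<Rightarrow> 'a::field"
  assumes k: "k < n" "v k \<noteq> 0"
  obtains P Q where "P \<in> carrier_mat n n" "Q \<in> carrier_mat n n" "P * Q = 1\<^sub>m n" "Q * P = 1\<^sub>m n"
    "\<And>i. i < n \<Longrightarrow> P $$ (i, 0) = v i"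
proof -
  define \<tau> where "\<tau> j = (if j = 0 then k else if j = k then 0 else j)" for j
  have \<tau>: "\<tau> j < n" "(\<tau> i = \<tau> j) = (i = j)" "(k = \<tau> j) = (j = 0)" if "j < n" for i j
    using k that by (auto simp: \<tau>_def)
  define P where "P = mat n n (\<lambda>(i, j). if j = 0 then v i else if i = \<tau> j then 1 else 0)"
  \<comment> \<open>Coordinates in that basis: row 0 reads coordinate k divided by
    \<open>v k\<close>; row j reads coordinate \<open>\<tau> j\<close> after subtracting the
    multiple of v.\<close>
  define Q where "Q = mat n n (\<lambda>(j, i). (if j = 0 then 0 else if i = \<tau> j then 1 else 0)
     + (if i = k then (if j = 0 then 1 else - v (\<tau> j)) / v k else 0))"
  have PQ: "P \<in> carrier_mat n n" "Q \<in> carrier_mat n n" by (auto simp: P_def Q_def)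
  have "Q * P = 1\<^sub>m n"
  proof (rule eq_matI)
    fix j l assume "j < dim_row (1\<^sub>m n)" "l < dim_col (1\<^sub>m n)"
    then have jl: "j < n" "l < n" by auto
    have "(Q * P) $$ (j, l) = (\<Sum>i<n. Q $$ (j, i) * P $$ (i, l))"
      using jl by (simp add: index_mult_mat_sum[OF PQ(2,1)] del: index_mult_mat(1))
    also have "\<dots> = (\<Sum>i<n. (if i = \<tau> j then (if j = 0 then 0 else P $$ (i, l)) else 0)
       + (if i = k then (if j = 0 then 1 else - v (\<tau> j)) / v k * P $$ (i, l) else 0))"
      using jl by (intro sum.cong) (auto simp: Q_def algebra_simps)
    also have "\<dots> = (if j = 0 then 0 else P $$ (\<tau> j, l)) + (if j = 0 then 1 else - v (\<tau> j)) / v k * P $$ (k, l)"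
      using jl k \<tau>[OF jl(1)] by (simp add: sum.distrib sum.delta)
    also have "\<dots> = 1\<^sub>m n $$ (j, l)"
      using jl k \<tau>[OF jl(1)] \<tau>(2,3)[OF jl(2)] by (auto simp: P_def)
    finally show "(Q * P) $$ (j, l) = 1\<^sub>m n $$ (j, l)" .
  qed (auto simp: P_def Q_def)
  moreover from mat_mult_left_right_inverse[OF PQ(2,1) this] have "P * Q = 1\<^sub>m n" .
  moreover have "P $$ (i, 0) = v i" if "i < n" for i using that k by (simp add: P_def)
  ultimately show ?thesis using that PQ by blast
qed

text \<open>Conjugation by a block unipotent matrix fixes the lower left block G, so w can steer
  both diagonal blocks at once.\<close>

lemma similar_mat_wit_unipotent_block:
  fixes X :: "'a::comm_ring_1 mat"
  assumes X: "X \<in> carrier_mat p p" and R: "R \<in> carrier_mat p q"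
    and G: "G \<in> carrier_mat q p" and D: "D \<in> carrier_mat q q" and w: "w \<in> carrier_mat p q"
  obtains R' where "R' \<in> carrier_mat p q"
    "similar_mat_wit (four_block_mat X R G D) (four_block_mat (X + w * G) R' G (D - G * w))
       (four_block_mat (1\<^sub>m p) (- w) (0\<^sub>m q p) (1\<^sub>m q)) (four_block_mat (1\<^sub>m p) w (0\<^sub>m q p) (1\<^sub>m q))"
proof -
  define U where "U = four_block_mat (1\<^sub>m p) w (0\<^sub>m q p) (1\<^sub>m q)"
  define V where "V = four_block_mat (1\<^sub>m p) (- w) (0\<^sub>m q p) (1\<^sub>m q)"
  define M where "M = four_block_mat X R G D"
  define R' where "R' = (X + w * G) * - w + (R + w * D)"
  note c = X R G D w
  have carr: "U \<in> carrier_mat (p + q) (p + q)" "V \<in> carrier_mat (p + q) (p + q)" "M \<in> carrier_mat (p + q) (p + q)"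
    using c by (auto simp: U_def V_def M_def)
  have [simp]: "- 0\<^sub>m q q = (0\<^sub>m q q :: 'a mat)" "w + - w = 0\<^sub>m p q" "- w + w = 0\<^sub>m p q"
    using w by (auto intro!: eq_matI)
  have "U * V = four_block_mat (1\<^sub>m p) (0\<^sub>m p q) (0\<^sub>m q p) (1\<^sub>m q)"
    unfolding U_def V_def using w
    by (subst mult_four_block_mat[of _ p p _ q _ q _ _ p _ q]) (auto intro!: arg_cong4[of _ _ _ _ _ _ _ _ four_block_mat])
  then have UV: "U * V = 1\<^sub>m (p + q)" by simp
  have "V * U = four_block_mat (1\<^sub>m p) (0\<^sub>m p q) (0\<^sub>m q p) (1\<^sub>m q)"
    unfolding U_def V_def using w
    by (subst mult_four_block_mat[of _ p p _ q _ q _ _ p _ q]) (auto intro!: arg_cong4[of _ _ _ _ _ _ _ _ four_block_mat])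
  then have VU: "V * U = 1\<^sub>m (p + q)" by simp
  have UM: "U * M = four_block_mat (X + w * G) (R + w * D) G D"
    unfolding U_def M_def using c
    by (subst mult_four_block_mat[of _ p p _ q _ q _ _ p _ q]) auto
  have "U * M * V = four_block_mat (X + w * G) R' G (D - G * w)"
    unfolding UM unfolding V_def R'_def using c
    by (subst mult_four_block_mat[of _ p p _ q _ q _ _ p _ q])
       (auto intro!: arg_cong4[of _ _ _ _ _ _ _ _ four_block_mat])
  moreover have "similar_mat_wit (U * M * V) M U V"
    using UV VU carr by (intro similar_mat_witI[of _ _ "p + q"]) auto
  ultimately have "similar_mat_wit M (four_block_mat (X + w * G) R' G (D - G * w)) V U"
    using similar_mat_wit_sym by metis
  moreover have "R' \<in> carrier_mat p q" using c by (auto simp: R'_def)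
  ultimately show ?thesis using that unfolding U_def V_def M_def by blast
qed

text \<open>
  Adding to \<open>w\<close> a row vector that annihilates \<open>G\<close> keeps \<open>w G\<close> and moves the entry \<open>(k, l)\<close> of
  \<open>D - G w\<close> off zero.
\<close>
lemma row_vector_making_block_nonscalar:
  fixes G :: "'a::field mat"
  assumes G: "G \<in> carrier_mat m 1" and D: "D \<in> carrier_mat m m" and k: "k < m" "G $$ (k, 0) \<noteq> 0"
  obtains w where "w \<in> carrier_mat 1 m" "(w * G) $$ (0, 0) = x" "m = 1 \<or> nonscalar (D - G * w)"
proof -
  define w where "w l e = mat 1 m (\<lambda>(i, j). (if j = k then x / G $$ (k, 0) else 0)
      + (e * (if j = l then G $$ (k, 0) else 0) - e * (if j = k then G $$ (l, 0) else 0)))" for l e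
  have wc: "w l e \<in> carrier_mat 1 m" for l e by (simp add: w_def)
  have wG: "(w l e * G) $$ (0, 0) = x" if "l < m" for l e
  proof -
    have "(w l e * G) $$ (0, 0) = (\<Sum>j<m. w l e $$ (0, j) * G $$ (j, 0))"
      using G wc[of l e] by (subst index_mult_mat_sum) auto
    also have "\<dots> = (\<Sum>j<m. (if j = k then x / G $$ (k, 0) * G $$ (k, 0) else 0)
      + (if j = l then e * G $$ (k, 0) * G $$ (l, 0) else 0) - (if j = k then e * G $$ (l, 0) * G $$ (k, 0) else 0))"
      by (intro sum.cong) (auto simp: w_def algebra_simps)
    also have "\<dots> = x" using k that by (simp add: sum.distrib sum_subtractf)
    finally show ?thesis .
  qed
  show ?thesis
  proof (cases "m = 1")
    case True
    then show ?thesis using that[of "w k 0"] wc wG[of k] k by auto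
  next
    case False
    define l where "l = (if k = 0 then 1 else 0 :: nat)"
    have l: "l < m" "l \<noteq> k" using False k by (auto simp: l_def)
    \<comment> \<open>The entry is affine in e with nonzero slope, so it is nonzero for e = 0 or e =
      1.\<close>
    have Dkl: "(D - G * w l e) $$ (k, l) = D $$ (k, l) - e * G $$ (k, 0) * G $$ (k, 0)" for e
      using k l G D wc[of l e]
      by (simp add: index_mult_mat_sum[OF G wc] del: index_mult_mat(1)) (simp add: w_def)
    obtain e where "(D - G * w l e) $$ (k, l) \<noteq> 0"
    proof (cases "D $$ (k, l) = 0")
      case True
      then show ?thesis using that[of 1] Dkl[of 1] k by simp
    next
      case False
      then show ?thesis using that[of 0] Dkl[of 0] k by simp
    qed
    then have "nonscalar (D - G * w l e)"
      using k l G D wc unfolding nonscalar_def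
      by - (rule exI[of _ k], rule conjI, simp, rule exI[of _ l], auto)
    then show ?thesis using that wc wG[OF l(1)] by blast
  qed
qed

text \<open>Take a vector v off the hyperplane with v and A v independent as first basis vector. The
  column below the corner is then nonzero, and a unipotent conjugation moves the corner to x while
  making the remaining block nonscalar.\<close>

lemma nonscalar_prescribe_corner:
  fixes A :: "'a::field_char_0 mat"
  assumes A: "A \<in> carrier_mat (Suc m) (Suc m)" "nonscalar A" and k: "k < Suc m" "\<psi> k \<noteq> 0"
  obtains R G D P Q j where "R \<in> carrier_mat 1 m" "G \<in> carrier_mat m 1" "D \<in> carrier_mat m m"
    "similar_mat_wit A (four_block_mat (mat 1 1 (\<lambda>_. x)) R G D) P Q"
    "j < m" "G $$ (j, 0) \<noteq> 0" "m = 1 \<or> nonscalar D" "(\<Sum>k<Suc m. \<psi> k * P $$ (k, 0)) \<noteq> 0"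
proof -
  let ?n = "Suc m"
  obtain v i j where v: "i < ?n" "j < ?n" "(\<Sum>k<?n. \<psi> k * v k) \<noteq> 0"
    "v i * (\<Sum>k<?n. A $$ (j, k) * v k) \<noteq> v j * (\<Sum>k<?n. A $$ (i, k) * v k)"
    by (rule nonscalar_noneigenvector[of A ?n k \<psi>, OF A k])
  then obtain k0 where "k0 < ?n" "v k0 \<noteq> 0" by (metis mult_zero_left)
  then obtain P Q where PQ: "P \<in> carrier_mat ?n ?n" "Q \<in> carrier_mat ?n ?n" "P * Q = 1\<^sub>m ?n" "Q * P = 1\<^sub>m ?n"
    and P0: "\<And>i. i < ?n \<Longrightarrow> P $$ (i, 0) = v i"
    by (rule invertible_with_first_column[of k0 ?n v]) blast
  define B where "B = Q * A * P"
  have B: "B \<in> carrier_mat ?n ?n" using PQ A by (auto simp: B_def)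
  have "similar_mat_wit B A Q P"
    using PQ A B by (intro similar_mat_witI[of _ _ ?n]) (auto simp: B_def)
  then have AB: "similar_mat_wit A B P Q" by (rule similar_mat_wit_sym)
  have AP: "A * P = P * B"
  proof -
    have "P * B = P * (Q * (A * P))" unfolding B_def using PQ A by (subst assoc_mult_mat) auto
    also have "\<dots> = P * Q * (A * P)" using PQ A by (subst assoc_mult_mat) auto
    also have "\<dots> = A * P" using PQ A by simp
    finally show ?thesis ..
  qed
  \<comment> \<open>Otherwise \<open>A * P = P * B\<close> would make v an eigenvector.\<close>
  have "\<exists>l<m. B $$ (Suc l, 0) \<noteq> 0"
  proof (rule ccontr)
    assume "\<not> ?thesis"
    then have B0: "B $$ (Suc l, 0) = 0" if "l < m" for l using that by blast
    have "(\<Sum>k<?n. A $$ (i, k) * v k) = v i * B $$ (0, 0)" if "i < ?n" for i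
    proof -
      have "(\<Sum>k<?n. A $$ (i, k) * v k) = (A * P) $$ (i, 0)"
        using that P0 by (subst index_mult_mat_sum[OF A(1) PQ(1)]) auto
      also have "\<dots> = (\<Sum>k<?n. P $$ (i, k) * B $$ (k, 0))"
        unfolding AP using that by (subst index_mult_mat_sum[OF PQ(1) B]) auto
      also have "\<dots> = v i * B $$ (0, 0)"
        unfolding sum.lessThan_Suc_shift using that P0 B0 by simp
      finally show ?thesis .
    qed
    then show False using v by simp
  qed
  then obtain l where l: "l < m" "B $$ (Suc l, 0) \<noteq> 0" by blast
  define X R G D where "X = mat 1 1 (\<lambda>_. B $$ (0, 0))" and "R = mat 1 m (\<lambda>(i, j). B $$ (0, Suc j))"
    and "G = mat m 1 (\<lambda>(i, j). B $$ (Suc i, 0))" and "D = mat m m (\<lambda>(i, j). B $$ (Suc i, Suc j))"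
  have bl: "X \<in> carrier_mat 1 1" "R \<in> carrier_mat 1 m" "G \<in> carrier_mat m 1" "D \<in> carrier_mat m m"
    by (simp_all add: X_def R_def G_def D_def)
  have Bbl: "B = four_block_mat X R G D"
    using B by (intro eq_matI) (auto simp: X_def R_def G_def D_def)
  have Gl: "G $$ (l, 0) \<noteq> 0" using l by (simp add: G_def)
  obtain w where w: "w \<in> carrier_mat 1 m" "(w * G) $$ (0, 0) = x - B $$ (0, 0)" "m = 1 \<or> nonscalar (D - G * w)"
    by (rule row_vector_making_block_nonscalar[OF bl(3,4) l(1) Gl])
  have Xw: "X + w * G = mat 1 1 (\<lambda>_. x)"
    using w(1,2) bl by (intro eq_matI) (auto simp: X_def)
  let ?V = "four_block_mat (1\<^sub>m 1) (- w) (0\<^sub>m m 1) (1\<^sub>m m)"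
  let ?U = "four_block_mat (1\<^sub>m 1) w (0\<^sub>m m 1) (1\<^sub>m m)"
  obtain R' where R': "R' \<in> carrier_mat 1 m"
    "similar_mat_wit B (four_block_mat (mat 1 1 (\<lambda>_. x)) R' G (D - G * w)) ?V ?U"
    unfolding Bbl by (rule similar_mat_wit_unipotent_block[OF bl w(1), unfolded Xw])
  have "similar_mat_wit A (four_block_mat (mat 1 1 (\<lambda>_. x)) R' G (D - G * w)) (P * ?V) (?U * Q)"
    by (rule similar_mat_wit_trans[OF AB R'(2)])
  \<comment> \<open>The unipotent factor has the unit vector as column 0, so v stays the first basis
    vector.\<close>
  moreover have "(P * ?V) $$ (k, 0) = v k" if "k < ?n" for k
  proof -
    have V: "?V \<in> carrier_mat ?n ?n" using w by auto
    have "(P * ?V) $$ (k, 0) = (\<Sum>l<?n. P $$ (k, l) * ?V $$ (l, 0))"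
      using that by (intro index_mult_mat_sum[OF PQ(1) V]) auto
    also have "\<dots> = v k" unfolding sum.lessThan_Suc_shift using w that P0 by simp
    finally show ?thesis .
  qed
  then have "(\<Sum>k<?n. \<psi> k * (P * ?V) $$ (k, 0)) \<noteq> 0" using v(3) by simp
  moreover have "D - G * w \<in> carrier_mat m m" using bl w(1) by auto
  ultimately show ?thesis using that R'(1) bl(3) l(1) Gl w(3) by blast
qed

text \<open>Carries a similarity of the lower block to the whole matrix without touching the corner:
  the inductive step for prescribing diagonals.\<close>

lemma similar_mat_wit_lower_block:
  fixes X :: "'a::comm_ring_1 mat"
  assumes "X \<in> carrier_mat 1 1" "R \<in> carrier_mat 1 m" "G \<in> carrier_mat m 1"
    and D: "D \<in> carrier_mat m m" and sim: "similar_mat_wit D E P Q"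
  shows "similar_mat_wit (four_block_mat X R G D) (four_block_mat X (R * P) (Q * G) E)
    (four_block_mat (1\<^sub>m 1) (0\<^sub>m 1 m) (0\<^sub>m m 1) P) (four_block_mat (1\<^sub>m 1) (0\<^sub>m 1 m) (0\<^sub>m m 1) Q)"
proof -
  note PQ = similar_mat_witD2[OF D sim]
  have "R * P * Q = R" using assms(2) PQ by (subst assoc_mult_mat[of _ 1 m _ m _ m]) auto
  moreover have "P * (Q * G) = G" using assms(3) PQ by (subst assoc_mult_mat[of _ m m _ m _ 1, symmetric]) auto
  ultimately show ?thesis
    using assms PQ(5,6,7)
    by (intro similar_mat_wit_four_block[OF similar_mat_wit_refl sim]) auto
qed

text \<open>
  Fillmore's theorem. The functional \<open>\<psi>\<close> gives control over an off-diagonal entry when the lemma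
  is applied to a diagonal block.
\<close>
lemma nonscalar_prescribe_diagonal:
  fixes A :: "'a::field_char_0 mat"
  assumes "A \<in> carrier_mat n n" "n = 1 \<or> nonscalar A" "k < n" "\<psi> k \<noteq> 0" "(\<Sum>i<n. d i) = mat_trace A"
  shows "\<exists>B P Q. similar_mat_wit A B P Q \<and> (\<forall>i<n. B $$ (i, i) = d i) \<and> (\<Sum>k<n. \<psi> k * P $$ (k, 0)) \<noteq> 0"
  using assms
proof (induction n arbitrary: A \<psi> k d)
  case 0
  then show ?case by simp
next
  case (Suc m)
  show ?case
  proof (cases "m = 0")
    case True
    then show ?thesis using Suc.prems similar_mat_wit_refl[of A 1]
      by (intro exI[of _ A] exI[of _ "1\<^sub>m 1"]) (auto simp: mat_trace_def)
  next
    case False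
    then have ns: "nonscalar A" using Suc.prems by simp
    obtain R G D P Q where RGD: "R \<in> carrier_mat 1 m" "G \<in> carrier_mat m 1" "D \<in> carrier_mat m m"
      and sim: "similar_mat_wit A (four_block_mat (mat 1 1 (\<lambda>_. d 0)) R G D) P Q"
      and D: "m = 1 \<or> nonscalar D" and P: "(\<Sum>k<Suc m. \<psi> k * P $$ (k, 0)) \<noteq> 0"
      by (rule nonscalar_prescribe_corner[of A m k \<psi> "d 0", OF Suc.prems(1) ns Suc.prems(3,4)]) blast
    have "mat_trace A = mat_trace (mat 1 1 (\<lambda>_. d 0)) + mat_trace D"
      unfolding mat_trace_similar[OF Suc.prems(1) sim] using RGD by (intro mat_trace_four_block) auto
    then have "(\<Sum>i<m. d (Suc i)) = mat_trace D"
      using Suc.prems(5) by (simp add: sum.lessThan_Suc_shift mat_trace_def del: sum.lessThan_Suc)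
    \<comment> \<open>Any nonzero functional serves inside the block; the condition on
      \<open>\<psi>\<close> is inherited from \<open>P\<close>, whose column 0 survives the block
      diagonal factor.\<close>
    with Suc.IH[OF RGD(3) D, of 0 "\<lambda>_. 1" "\<lambda>i. d (Suc i)"] False obtain E P' Q' where
      E: "similar_mat_wit D E P' Q'" "\<And>i. i < m \<Longrightarrow> E $$ (i, i) = d (Suc i)" by auto
    note PQ = similar_mat_witD2[OF RGD(3) E(1)] similar_mat_witD2[OF Suc.prems(1) sim]
    let ?B = "four_block_mat (mat 1 1 (\<lambda>_. d 0)) (R * P') (Q' * G) E"
    let ?P = "four_block_mat (1\<^sub>m 1) (0\<^sub>m 1 m) (0\<^sub>m m 1) P'"
    let ?Q = "four_block_mat (1\<^sub>m 1) (0\<^sub>m 1 m) (0\<^sub>m m 1) Q'"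
    have "similar_mat_wit A ?B (P * ?P) (?Q * Q)"
      using RGD E(1) by (intro similar_mat_wit_trans[OF sim similar_mat_wit_lower_block]) auto
    moreover have "\<forall>i<Suc m. ?B $$ (i, i) = d i"
      using PQ E(2) by auto
    moreover have "(P * ?P) $$ (k, 0) = P $$ (k, 0)" if "k < Suc m" for k
    proof -
      have "?P \<in> carrier_mat (Suc m) (Suc m)" using PQ by auto
      then have "(P * ?P) $$ (k, 0) = (\<Sum>l<Suc m. P $$ (k, l) * ?P $$ (l, 0))"
        using that by (intro index_mult_mat_sum[OF PQ(13)]) auto
      also have "\<dots> = P $$ (k, 0)" unfolding sum.lessThan_Suc_shift using PQ by simp
      finally show ?thesis .
    qed
    then have "(\<Sum>k<Suc m. \<psi> k * (P * ?P) $$ (k, 0)) \<noteq> 0" using P by simp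
    ultimately show ?thesis by blast
  qed
qed

lemma similar_mat_wit_transpose:
  fixes A :: "'a::comm_ring_1 mat"
  assumes A: "A \<in> carrier_mat n n" and sim: "similar_mat_wit A B P Q"
  shows "similar_mat_wit (transpose_mat A) (transpose_mat B) (transpose_mat Q) (transpose_mat P)"
proof -
  note D = similar_mat_witD2[OF A sim]
  have "transpose_mat A = transpose_mat Q * (transpose_mat B * transpose_mat P)"
    unfolding D(3) using D by (simp add: transpose_mult[of _ n n _ n])
  also have "\<dots> = transpose_mat Q * transpose_mat B * transpose_mat P"
    using D(4-7) by (subst assoc_mult_mat[of _ n n _ n _ n]) auto
  finally have "transpose_mat A = \<dots>" .
  moreover have "transpose_mat Q * transpose_mat P = 1\<^sub>m n" "transpose_mat P * transpose_mat Q = 1\<^sub>m n"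
    using transpose_mult[OF D(6,7)] transpose_mult[OF D(7,6)] unfolding D(1,2) transpose_one by simp_all
  ultimately show ?thesis
    using D(4-7) by (intro similar_mat_witI[of _ _ n]) auto
qed

text \<open>Nonscalar matrices fall under Fillmore's theorem; otherwise the diagonal is constant,
  hence zero in characteristic 0.\<close>

lemma trace_zero_similar_zero_diagonal:
  fixes A :: "'a::field_char_0 mat"
  assumes A: "A \<in> carrier_mat n n" and n: "n > 0" and trA: "mat_trace A = 0"
  obtains B P Q where "similar_mat_wit A B P Q" "\<And>i. i < n \<Longrightarrow> B $$ (i, i) = 0"
proof (cases "nonscalar A")
  case True
  then show ?thesis
    using nonscalar_prescribe_diagonal[OF A _ n, of "\<lambda>_. 1" "\<lambda>_. 0"] trA that by auto
next
  case False
  then have eq: "A $$ (i, i) = A $$ (0, 0)" if "i < n" for i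
    using n A that by (cases "i = 0") (auto simp: nonscalar_def)
  have "mat_trace A = (\<Sum>i<n. A $$ (0, 0))"
    unfolding mat_trace_def using A by (intro sum.cong eq) auto
  then have "A $$ (0, 0) = 0" using trA n by simp
  then have "A $$ (i, i) = 0" if "i < n" for i using eq[OF that] by argo
  then show ?thesis using that similar_mat_wit_refl[OF A] by blast
qed

text \<open>The corner lemma makes the column below the corner nonzero. Transposing turns it into a
  nonzero row, and this row is the functional for Fillmore's theorem on the block, whose
  nonvanishing is exactly that of entry (0, 1).\<close>

lemma nonscalar_prescribe_two_diagonal:
  fixes A :: "'a::field_char_0 mat"
  assumes A: "A \<in> carrier_mat n n" "nonscalar A" and trA: "x + y = mat_trace A"
  obtains B P Q where "similar_mat_wit A B P Q" "B $$ (0, 0) = x" "B $$ (1, 1) = y"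
    "\<And>i. i < n \<Longrightarrow> i \<ge> 2 \<Longrightarrow> B $$ (i, i) = 0" "B $$ (0, 1) \<noteq> 0"
proof -
  from A obtain i j where "i < n" "j < n" "i \<noteq> j" by (auto simp: nonscalar_def)
  then obtain m where n: "n = Suc m" "m > 0" by (cases n) auto
  have T: "transpose_mat A \<in> carrier_mat (Suc m) (Suc m)" "nonscalar (transpose_mat A)"
    using A nonscalar_transpose[OF A] n by auto
  obtain R G D P Q j where RGD: "R \<in> carrier_mat 1 m" "G \<in> carrier_mat m 1" "D \<in> carrier_mat m m"
    and sim: "similar_mat_wit (transpose_mat A) (four_block_mat (mat 1 1 (\<lambda>_. x)) R G D) P Q"
    and j: "j < m" "G $$ (j, 0) \<noteq> 0" and D: "m = 1 \<or> nonscalar D"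
    by (rule nonscalar_prescribe_corner[of _ m 0 "\<lambda>_. 1" x, OF T]) auto
  let ?X = "mat 1 1 (\<lambda>_. x)"
  let ?G = "transpose_mat G" and ?R = "transpose_mat R" and ?D = "transpose_mat D"
  have X: "?X \<in> carrier_mat 1 1" by simp
  have RGD': "?G \<in> carrier_mat 1 m" "?R \<in> carrier_mat m 1" "?D \<in> carrier_mat m m" using RGD by auto
  have "transpose_mat (four_block_mat ?X R G D) = four_block_mat ?X ?G ?R ?D"
    using transpose_four_block_mat[OF X RGD] by (auto intro!: arg_cong4[of _ _ _ _ _ _ _ _ four_block_mat] eq_matI)
  with similar_mat_wit_transpose[OF T(1) sim]
  have sim': "similar_mat_wit A (four_block_mat ?X ?G ?R ?D) (transpose_mat Q) (transpose_mat P)" by simp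
  have D': "m = 1 \<or> nonscalar ?D" using D nonscalar_transpose[OF RGD(3)] by blast
  have trX: "mat_trace ?X = x" by (simp add: mat_trace_def)
  have "mat_trace A = mat_trace ?X + mat_trace ?D"
    unfolding mat_trace_similar[OF A(1) sim'] using RGD' by (intro mat_trace_four_block) auto
  then have trD: "(\<Sum>i<m. if i = 0 then y else 0) = mat_trace ?D"
    unfolding trX using trA n by simp
  have "?G $$ (0, j) \<noteq> 0" using j RGD by auto
  then obtain E P' Q' where E: "similar_mat_wit ?D E P' Q'"
    "\<And>i. i < m \<Longrightarrow> E $$ (i, i) = (if i = 0 then y else 0)" "(\<Sum>k<m. ?G $$ (0, k) * P' $$ (k, 0)) \<noteq> 0"
    using nonscalar_prescribe_diagonal[OF RGD'(3) D' j(1) _ trD, of "\<lambda>k. ?G $$ (0, k)"] by blast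
  note PQ = similar_mat_witD2[OF RGD'(3) E(1)]
  let ?B = "four_block_mat ?X (?G * P') (Q' * ?R) E"
  have "similar_mat_wit A ?B (transpose_mat Q * four_block_mat (1\<^sub>m 1) (0\<^sub>m 1 m) (0\<^sub>m m 1) P')
     (four_block_mat (1\<^sub>m 1) (0\<^sub>m 1 m) (0\<^sub>m m 1) Q' * transpose_mat P)"
    using RGD' E(1) by (intro similar_mat_wit_trans[OF sim' similar_mat_wit_lower_block]) auto
  moreover have "(?G * P') $$ (0, 0) \<noteq> 0"
    using E(3) n by (subst index_mult_mat_sum[OF RGD'(1) PQ(6)]) auto
  then have "?B $$ (0, 1) \<noteq> 0"
    using PQ RGD' n by simp
  moreover have "?B $$ (0, 0) = x" "?B $$ (1, 1) = y" "\<And>i. i < n \<Longrightarrow> i \<ge> 2 \<Longrightarrow> ?B $$ (i, i) = 0"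
    using PQ RGD' n E(2) by auto
  ultimately show ?thesis using that by blast
qed

section \<open>Scalar matrices and weighted shifts\<close>

text \<open>
  These are the diagonal entries of \<open>f(a, b, c) = 1\<close> for a subdiagonal shift \<open>a\<close>, superdiagonal weights
  \<open>w\<close> and \<open>c\<close> diagonal. The junk value \<open>c (0 - 1)\<close> is harmless because \<open>w 0 = 0\<close>.
\<close>
definition weight_chain :: "'a::field \<Rightarrow> 'a \<Rightarrow> 'a \<Rightarrow> 'a \<Rightarrow> nat \<Rightarrow> bool" where
  "weight_chain A B C E n \<longleftrightarrow> (\<exists>c w. w 0 = 0 \<and> w n = 0 \<and>
     (\<forall>i<n. w i * (A * c i + B * c (i - 1)) + w (Suc i) * (E * c i + C * c (Suc i)) = 1))"

text \<open>The weight at the junction is 0 and multiplies every term in which c crosses from one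
  chain to the other.\<close>

lemma weight_chain_add:
  assumes "weight_chain A B C E p" "weight_chain A B C E q"
  shows "weight_chain A B C E (p + q)"
proof -
  obtain c w where cw: "w 0 = 0" "w p = 0"
    "\<And>i. i < p \<Longrightarrow> w i * (A * c i + B * c (i - 1)) + w (Suc i) * (E * c i + C * c (Suc i)) = 1"
    using assms(1) unfolding weight_chain_def by blast
  obtain c' w' where cw': "w' 0 = 0" "w' q = 0"
    "\<And>i. i < q \<Longrightarrow> w' i * (A * c' i + B * c' (i - 1)) + w' (Suc i) * (E * c' i + C * c' (Suc i)) = 1"
    using assms(2) unfolding weight_chain_def by blast
  define c2 where "c2 i = (if i < p then c i else c' (i - p))" for i
  define w2 where "w2 i = (if i < p then w i else w' (i - p))" for i
  have "w2 i * (A * c2 i + B * c2 (i - 1)) + w2 (Suc i) * (E * c2 i + C * c2 (Suc i)) = 1"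
    if i: "i < p + q" for i
  proof -
    consider "Suc i < p" | "Suc i = p" | "i = p" | "i > p" by linarith
    then show ?thesis
    proof cases
      case 1
      then show ?thesis using cw(3)[of i] by (simp add: c2_def w2_def)
    next
      case 2
      then show ?thesis using cw(2) cw(3)[of i] cw'(1) by (auto simp: c2_def w2_def)
    next
      case 3
      then show ?thesis using cw'(1) cw'(3)[of 0] i by (simp add: c2_def w2_def)
    next
      case 4
      then have "i - Suc 0 - p = i - p - Suc 0" "\<not> i - Suc 0 < p" "Suc i - p = Suc (i - p)" by auto
      with 4 show ?thesis using cw'(3)[of "i - p"] i by (simp add: c2_def w2_def)
    qed
  qed
  moreover have "w2 0 = 0" "w2 (p + q) = 0" using cw cw' by (auto simp: w2_def)
  ultimately show ?thesis unfolding weight_chain_def by blast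
qed

text \<open>A vanishing weight decouples the system, so solutions of lengths 2 and 3 can be concatenated.\<close>
lemma weight_chain_exists:
  fixes A B C E :: "'a::field_char_0"
  assumes sum0: "A + B + C + E = 0" and "A + B \<noteq> 0" "A + C \<noteq> 0" and n: "n \<ge> 2"
  shows "weight_chain A B C E n"
proof -
  \<comment> \<open>Determinant of the system E p + C q = u, B p + A q = v. With coefficient sum 0
    it factors as -(A + B)(A + C).\<close>
  define \<Delta> where "\<Delta> = E * A - B * C"
  have E: "E = - A - B - C" using sum0 by (simp add: algebra_simps eq_neg_iff_add_eq_0)
  have "\<Delta> = - ((A + B) * (A + C))" unfolding \<Delta>_def E by (simp add: algebra_simps)
  then have \<Delta>: "\<Delta> \<noteq> 0" using assms by simp
  have cramer: "E * ((A * u - C * v) / \<Delta>) + C * ((E * v - B * u) / \<Delta>) = u"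
    "B * ((A * u - C * v) / \<Delta>) + A * ((E * v - B * u) / \<Delta>) = v" for u v
  proof -
    have "E * ((A * u - C * v) / \<Delta>) + C * ((E * v - B * u) / \<Delta>) = (u * \<Delta>) / \<Delta>"
      by (simp add: \<Delta>_def add_divide_distrib[symmetric] algebra_simps)
    then show "E * ((A * u - C * v) / \<Delta>) + C * ((E * v - B * u) / \<Delta>) = u" using \<Delta> by simp
    have "B * ((A * u - C * v) / \<Delta>) + A * ((E * v - B * u) / \<Delta>) = (v * \<Delta>) / \<Delta>"
      by (simp add: \<Delta>_def add_divide_distrib[symmetric] algebra_simps)
    then show "B * ((A * u - C * v) / \<Delta>) + A * ((E * v - B * u) / \<Delta>) = v" using \<Delta> by simp
  qed
  have two: "weight_chain A B C E 2"
    unfolding weight_chain_def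
  proof (intro exI conjI allI impI)
    let ?c = "\<lambda>i::nat. if i = 0 then (A * 1 - C * 1) / \<Delta> else (E * 1 - B * 1) / \<Delta>"
    let ?w = "\<lambda>i::nat. if i = 1 then 1 else 0 :: 'a"
    show "?w i * (A * ?c i + B * ?c (i - 1)) + ?w (Suc i) * (E * ?c i + C * ?c (Suc i)) = 1" if "i < 2" for i
    proof -
      from that consider "i = 0" | "i = 1" by linarith
      then show ?thesis using cramer[of 1 1] by cases (auto simp: add.commute)
    qed
  qed auto
  have three: "weight_chain A B C E 3"
  proof -
    have EB: "E \<noteq> 0 \<or> B \<noteq> 0" and AC: "A \<noteq> 0 \<or> C \<noteq> 0" using \<Delta> by (auto simp: \<Delta>_def)
    \<comment> \<open>The middle equation is split as t + (1 - t), leaving two 2 by 2 systems. The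
      weights u and v must be nonzero; each condition excludes at most one t, so one of 0, 1, 2
      works.\<close>
    obtain t where t: "E * t - B * 1 \<noteq> 0" "A * (1 - t) - C * 1 \<noteq> 0"
    proof -
      have *: "s = t" if "E * s - B * 1 = 0" "E * t - B * 1 = 0" for s t
        using that EB by auto
      have **: "s = t" if "A * (1 - s) - C * 1 = 0" "A * (1 - t) - C * 1 = 0" for s t
        using that AC by auto
      show ?thesis
        using that[of 0] that[of 1] that[of 2] *[of 0 1] *[of 0 2] *[of 1 2] **[of 0 1] **[of 0 2] **[of 1 2]
        by (metis zero_neq_one zero_neq_numeral one_eq_numeral_iff num.distinct(1))
    qed
    \<comment> \<open>With \<open>c 1 = 1\<close>, the unknowns are the weights u, v and the
      products p = u \<open>c 0\<close>, r = v \<open>c 2\<close>, in which the equations are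
      linear.\<close>
    define u v where "u = (E * t - B * 1) / \<Delta>" and "v = (A * (1 - t) - C * 1) / \<Delta>"
    define p r where "p = (A * 1 - C * t) / \<Delta>" and "r = (E * 1 - B * (1 - t)) / \<Delta>"
    have uv: "u \<noteq> 0" "v \<noteq> 0" using t \<Delta> by (auto simp: u_def v_def)
    have eqs: "E * p + C * u = 1" "B * p + A * u = t" "E * v + C * r = 1 - t" "B * v + A * r = 1"
      unfolding u_def v_def p_def r_def using cramer[of 1 t] cramer[of "1 - t" 1] by auto
    let ?c = "\<lambda>i::nat. if i = 0 then p / u else if i = 1 then 1 else r / v"
    let ?w = "\<lambda>i::nat. if i = 1 then u else if i = 2 then v else 0"
    show ?thesis
      unfolding weight_chain_def
    proof (intro exI conjI allI impI)
      show "?w i * (A * ?c i + B * ?c (i - 1)) + ?w (Suc i) * (E * ?c i + C * ?c (Suc i)) = 1"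
        if "i < 3" for i
      proof -
        from that consider "i = 0" | "i = 1" | "i = 2" by linarith
        then show ?thesis
        proof cases
          case 1
          then show ?thesis using eqs(1) uv by (simp add: algebra_simps)
        next
          case 2
          have "u * (A + B * (p / u)) + v * (E + C * (r / v)) = (B * p + A * u) + (E * v + C * r)"
            using uv by (simp add: algebra_simps)
          then show ?thesis using 2 eqs(2,3) by simp
        next
          case 3
          then show ?thesis using eqs(4) uv by (simp add: algebra_simps)
        qed
      qed
    qed auto
  qed
  show ?thesis using n
  proof (induction n rule: less_induct)
    case (less n)
    show ?case
    proof (cases "n < 4")
      case True
      then have "n = 2 \<or> n = 3" using less.prems by auto
      then show ?thesis using two three by auto
    next
      case False
      then have "weight_chain A B C E (2 + (n - 2))"
        using less.IH[of "n - 2"] by (intro weight_chain_add two) auto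
      moreover have "2 + (n - 2) = n" using False by simp
      ultimately show ?thesis by argo
    qed
  qed
qed

section \<open>Images of multilinear cubic polynomials\<close>

definition cubic :: "'a \<Rightarrow> 'a \<Rightarrow> 'a \<Rightarrow> 'a \<Rightarrow> 'a \<Rightarrow> 'a \<Rightarrow> 'a mat \<Rightarrow> 'a mat \<Rightarrow> 'a mat \<Rightarrow> 'a::field_char_0 mat" where
  "cubic l1 l2 l3 m1 m2 m3 a b c =
     l1 \<cdot>\<^sub>m (a * b * c) + l2 \<cdot>\<^sub>m (b * c * a) + l3 \<cdot>\<^sub>m (c * a * b)
     + m1 \<cdot>\<^sub>m (c * b * a) + m2 \<cdot>\<^sub>m (a * c * b) + m3 \<cdot>\<^sub>m (b * a * c)"

definition cubic_image :: "nat \<Rightarrow> 'a \<Rightarrow> 'a \<Rightarrow> 'a \<Rightarrow> 'a \<Rightarrow> 'a \<Rightarrow> 'a \<Rightarrow> 'a::field_char_0 mat set" where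
  "cubic_image n l1 l2 l3 m1 m2 m3 = {cubic l1 l2 l3 m1 m2 m3 a b c | a b c.
     a \<in> carrier_mat n n \<and> b \<in> carrier_mat n n \<and> c \<in> carrier_mat n n}"

lemma cubic_imageI:
  "a \<in> carrier_mat n n \<Longrightarrow> b \<in> carrier_mat n n \<Longrightarrow> c \<in> carrier_mat n n \<Longrightarrow>
    cubic l1 l2 l3 m1 m2 m3 a b c = A \<Longrightarrow> A \<in> cubic_image n l1 l2 l3 m1 m2 m3"
  unfolding cubic_image_def by blast

lemma cubic_carrier [simp]:
  "a \<in> carrier_mat n n \<Longrightarrow> b \<in> carrier_mat n n \<Longrightarrow> c \<in> carrier_mat n n \<Longrightarrow>
    cubic l1 l2 l3 m1 m2 m3 a b c \<in> carrier_mat n n"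
  by (simp add: cubic_def)

lemma cubic_dim [simp]:
  "dim_row (cubic l1 l2 l3 m1 m2 m3 a b c) = dim_row b" "dim_col (cubic l1 l2 l3 m1 m2 m3 a b c) = dim_col c"
  by (simp_all add: cubic_def)

lemma mat_diag_dims [simp]: "dim_row (mat_diag n f) = n" "dim_col (mat_diag n f) = n"
  by (simp_all add: mat_diag_def)

lemma cubic_index:
  assumes "a \<in> carrier_mat n n" "b \<in> carrier_mat n n" "c \<in> carrier_mat n n" "i < n" "j < n"
  shows "cubic l1 l2 l3 m1 m2 m3 a b c $$ (i, j) =
     l1 * (a * b * c) $$ (i, j) + l2 * (b * c * a) $$ (i, j) + l3 * (c * a * b) $$ (i, j)
     + m1 * (c * b * a) $$ (i, j) + m2 * (a * c * b) $$ (i, j) + m3 * (b * a * c) $$ (i, j)"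
  using assms by (simp add: cubic_def del: index_mult_mat(1))

lemma cubic_image_subset: "cubic_image n l1 l2 l3 m1 m2 m3 \<subseteq> carrier_mat n n"
  by (auto simp: cubic_image_def)

text \<open>Renaming the variables cyclically rotates both coefficient triples, so whichever
  commutator constant is nonzero can be moved to the first position.\<close>

lemma cubic_image_rotate: "cubic_image n l1 l2 l3 m1 m2 m3 = cubic_image n l2 l3 l1 m2 m3 m1"
proof -
  have eq: "cubic l1 l2 l3 m1 m2 m3 a b c = cubic l2 l3 l1 m2 m3 m1 b c a"
    if "a \<in> carrier_mat n n" "b \<in> carrier_mat n n" "c \<in> carrier_mat n n" for a b c
    using that by (intro eq_matI) (auto simp: cubic_def algebra_simps simp del: index_mult_mat(1))
  show ?thesis unfolding cubic_image_def using eq by (metis (no_types, opaque_lifting))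
qed

lemma nc_eval_cubic:
  assumes abc: "a \<in> carrier_mat n n" "b \<in> carrier_mat n n" "c \<in> carrier_mat n n"
  shows "nc_eval n (nc_subst a b c)
     (let x = nc_var Ind_x; y = nc_var Ind_y; z = nc_var Ind_z in
        nc_const l1 * (x * y * z) + nc_const l2 * (y * z * x) + nc_const l3 * (z * x * y)
          + nc_const m1 * (z * y * x) + nc_const m2 * (x * z * y) + nc_const m3 * (y * x * z))
   = cubic l1 l2 l3 m1 m2 m3 a b c"
proof -
  define s where "s = nc_subst a b c"
  have sv: "s Ind_x = a" "s Ind_y = b" "s Ind_z = c" by (simp_all add: s_def nc_subst_def)
  have s: "s v \<in> carrier_mat n n" for v
    using abc sv by (cases v) simp_all
  have k: "k \<cdot>\<^sub>m 1\<^sub>m n * M = k \<cdot>\<^sub>m M" if "M \<in> carrier_mat n n" for k and M :: "'a mat"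
    using that by (simp add: mult_smult_assoc_mat[of _ n n _ n])
  show ?thesis
    unfolding s_def[symmetric] Let_def nc_eval_add nc_eval_mult[OF s] nc_eval_const[OF s] nc_eval_var[OF s] sv cubic_def
    using abc by (simp add: k)
qed

text \<open>Conjugation is an algebra automorphism and commutes with f, so targets may be put in
  normal form.\<close>

lemma cubic_image_similar:
  assumes A: "A \<in> carrier_mat n n" and sim: "similar_mat_wit A B P Q"
    and B: "B \<in> cubic_image n l1 l2 l3 m1 m2 m3"
  shows "A \<in> cubic_image n l1 l2 l3 m1 m2 m3"
proof -
  note PQ = similar_mat_witD2[OF A sim]
  obtain a b c where abc: "a \<in> carrier_mat n n" "b \<in> carrier_mat n n" "c \<in> carrier_mat n n"
    and eq: "B = cubic l1 l2 l3 m1 m2 m3 a b c" using B by (auto simp: cubic_image_def)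
  have two: "(P * u * Q) * (P * v * Q) = P * (u * v) * Q" if "u \<in> carrier_mat n n" "v \<in> carrier_mat n n" for u v
  proof -
    have "(P * u * Q) * (P * v * Q) = P * (u * (Q * (P * (v * Q))))"
      using that PQ(6,7) by (simp add: assoc_mult_mat[of _ n n _ n _ n])
    also have "Q * (P * (v * Q)) = (Q * P) * (v * Q)"
      using that PQ(6,7) by (simp add: assoc_mult_mat[of _ n n _ n _ n])
    also have "\<dots> = v * Q" using that PQ(2,7) by simp
    finally show ?thesis using that PQ(6,7) by (simp add: assoc_mult_mat[of _ n n _ n _ n])
  qed
  have dist: "P * (u + v) * Q = P * u * Q + P * v * Q" if "u \<in> carrier_mat n n" "v \<in> carrier_mat n n" for u v
    using that PQ(6,7) by (simp add: mult_add_distrib_mat[of _ n n _ n] add_mult_distrib_mat[of _ n n _ _ n])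
  have smult: "P * (k \<cdot>\<^sub>m u) * Q = k \<cdot>\<^sub>m (P * u * Q)" if "u \<in> carrier_mat n n" for k u
    using that PQ(6,7) by (simp add: mult_smult_distrib[of _ n n _ n] mult_smult_assoc_mat[of _ n n _ n])
  have "cubic l1 l2 l3 m1 m2 m3 (P * a * Q) (P * b * Q) (P * c * Q) = P * cubic l1 l2 l3 m1 m2 m3 a b c * Q"
    unfolding cubic_def using abc by (simp add: two dist smult)
  then have "cubic l1 l2 l3 m1 m2 m3 (P * a * Q) (P * b * Q) (P * c * Q) = A" using PQ(3) eq by simp
  then show ?thesis using abc PQ(6,7) by (intro cubic_imageI) auto
qed

section \<open>Traces of values and traceless targets\<close>

lemma mat_trace_add: "A \<in> carrier_mat n n \<Longrightarrow> B \<in> carrier_mat n n \<Longrightarrow> mat_trace (A + B) = mat_trace A + mat_trace B"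
  by (simp add: mat_trace_def sum.distrib)

lemma mat_trace_smult: "A \<in> carrier_mat n n \<Longrightarrow> mat_trace (k \<cdot>\<^sub>m A) = k * mat_trace A"
  by (simp add: mat_trace_def sum_distrib_left)

text \<open>The six monomials form two classes under cyclic rotation, on each of which the trace is
  constant.\<close>

lemma mat_trace_cubic:
  assumes abc: "a \<in> carrier_mat n n" "b \<in> carrier_mat n n" "c \<in> carrier_mat n n"
  shows "mat_trace (cubic l1 l2 l3 m1 m2 m3 a b c) = (l1 + l2 + l3) * mat_trace (a * b * c) + (m1 + m2 + m3) * mat_trace (a * c * b)"
proof -
  have rot: "mat_trace (y * z * x) = mat_trace (x * y * z)"
    if "x \<in> carrier_mat n n" "y \<in> carrier_mat n n" "z \<in> carrier_mat n n" for x y z :: "'a mat"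
    using mat_trace_mult_comm[of "y * z" n n x] that by (simp add: assoc_mult_mat[of _ n n _ n _ n])
  have "mat_trace (b * c * a) = mat_trace (a * b * c)" "mat_trace (c * a * b) = mat_trace (a * b * c)"
       "mat_trace (c * b * a) = mat_trace (a * c * b)" "mat_trace (b * a * c) = mat_trace (a * c * b)"
    using rot abc by metis+
  then show ?thesis
    using abc by (simp add: cubic_def mat_trace_add[of _ n] mat_trace_smult[of _ n] algebra_simps)
qed

lemma cubic_image_traceless:
  assumes "l1 + l2 + l3 = 0" "m1 + m2 + m3 = 0"
  shows "cubic_image n l1 l2 l3 m1 m2 m3 \<subseteq> {A \<in> carrier_mat n n. mat_trace A = 0}"
  using assms by (auto simp: cubic_image_def mat_trace_cubic)

lemma traceless_in_cubic_image:
  assumes zd: "\<And>B. B \<in> carrier_mat n n \<Longrightarrow> (\<And>i. i < n \<Longrightarrow> B $$ (i, i) = 0) \<Longrightarrow> B \<in> cubic_image n l1 l2 l3 m1 m2 m3"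
    and n: "n > 0" and A: "A \<in> carrier_mat n n" "mat_trace A = 0"
  shows "A \<in> cubic_image n l1 l2 l3 m1 m2 m3"
proof -
  obtain B P Q where B: "similar_mat_wit A B P Q" "\<And>i. i < n \<Longrightarrow> B $$ (i, i) = 0"
    using trace_zero_similar_zero_diagonal[OF A(1) n A(2)] by blast
  show ?thesis
    using similar_mat_witD2(5)[OF A(1) B(1)] B(2) by (intro cubic_image_similar[OF A(1) B(1)] zd)
qed

text \<open>For \<open>a = diag(0, 1, \<dots>, n - 1)\<close> the map \<open>b \<mapsto> f(a, b, 1) = \<alpha> [a, b]\<close> is onto the matrices with zero diagonal.\<close>
lemma traceless_in_cubic_image_commutator:
  assumes sum0: "l1 + l2 + l3 + m1 + m2 + m3 = 0" and \<alpha>: "l1 + l3 + m2 \<noteq> 0"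
    and n: "n > 0" and A: "A \<in> carrier_mat n n" "mat_trace A = 0"
  shows "A \<in> cubic_image n l1 l2 l3 m1 m2 m3"
proof (rule traceless_in_cubic_image[OF _ n A])
  fix B :: "'a mat" assume B: "B \<in> carrier_mat n n" "\<And>i. i < n \<Longrightarrow> B $$ (i, i) = 0"
  define \<alpha> where "\<alpha> = l1 + l3 + m2"
  have m1: "m1 = - \<alpha> - l2 - m3" using sum0 by (simp add: \<alpha>_def algebra_simps eq_neg_iff_add_eq_0)
  define a where "a = mat_diag n (\<lambda>i. of_nat i :: 'a)"
  \<comment> \<open>Off the diagonal the denominators are nonzero by characteristic 0; on it both
    sides vanish.\<close>
  define b where "b = mat n n (\<lambda>(i, j). B $$ (i, j) / (\<alpha> * (of_nat i - of_nat j)))"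
  have c: "a \<in> carrier_mat n n" "b \<in> carrier_mat n n" "1\<^sub>m n \<in> carrier_mat n n" by (simp_all add: a_def b_def)
  have ab: "(a * b) $$ (i, j) = of_nat i * b $$ (i, j)" "(b * a) $$ (i, j) = b $$ (i, j) * of_nat j"
    if "i < n" "j < n" for i j
    using that c by (simp_all add: a_def mat_diag_mult_left[of _ n n] mat_diag_mult_right[of _ n n])
  have "cubic l1 l2 l3 m1 m2 m3 a b (1\<^sub>m n) = B"
  proof (rule eq_matI)
    fix i j assume "i < dim_row B" "j < dim_col B"
    then have ij: "i < n" "j < n" using B by auto
    have "cubic l1 l2 l3 m1 m2 m3 a b (1\<^sub>m n) $$ (i, j) = \<alpha> * ((of_nat i - of_nat j) * b $$ (i, j))"
      using ij c by (simp add: cubic_index[where n = n] ab m1 \<alpha>_def algebra_simps del: index_mult_mat(1))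
    also have "\<dots> = B $$ (i, j)"
      using ij B(2) \<alpha> by (cases "i = j") (simp_all add: b_def \<alpha>_def)
    finally show "cubic l1 l2 l3 m1 m2 m3 a b (1\<^sub>m n) $$ (i, j) = B $$ (i, j)" .
  qed (use B c in auto)
  then show "B \<in> cubic_image n l1 l2 l3 m1 m2 m3" using c by (intro cubic_imageI)
qed

text \<open>Here \<open>f\<close> is a Lie polynomial and \<open>f(a, b, a) = - l1 [a, [a, b]]\<close>.\<close>
lemma traceless_in_cubic_image_Lie:
  assumes sum0: "l1 + l2 + l3 = 0" and l1: "l1 \<noteq> 0"
    and n: "n > 0" and A: "A \<in> carrier_mat n n" "mat_trace A = 0"
  shows "A \<in> cubic_image n l1 l2 l3 l1 l2 l3"
proof (rule traceless_in_cubic_image[OF _ n A])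
  fix B :: "'a mat" assume B: "B \<in> carrier_mat n n" "\<And>i. i < n \<Longrightarrow> B $$ (i, i) = 0"
  have l3: "l3 = - l1 - l2" using sum0 by (simp add: algebra_simps eq_neg_iff_add_eq_0)
  define a where "a = mat_diag n (\<lambda>i. of_nat i :: 'a)"
  \<comment> \<open>Bracketing twice with a multiplies entry (i, j) by the square of i - j.\<close>
  define b where "b = mat n n (\<lambda>(i, j). B $$ (i, j) / (- l1 * (of_nat i - of_nat j)\<^sup>2))"
  have c: "a \<in> carrier_mat n n" "b \<in> carrier_mat n n" by (simp_all add: a_def b_def)
  have ax: "(a * x) $$ (i, j) = of_nat i * x $$ (i, j)" "(x * a) $$ (i, j) = x $$ (i, j) * of_nat j"
    if "i < n" "j < n" "x \<in> carrier_mat n n" for i j x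
    using that c by (simp_all add: a_def mat_diag_mult_left[of _ n n] mat_diag_mult_right[of _ n n])
  have assoc: "a * a * b = a * (a * b)" "b * (a * a) = b * a * a" using c by simp_all
  have "cubic l1 l2 l3 l1 l2 l3 a b a = B"
  proof (rule eq_matI)
    fix i j assume "i < dim_row B" "j < dim_col B"
    then have ij: "i < n" "j < n" using B by auto
    have "cubic l1 l2 l3 l1 l2 l3 a b a $$ (i, j) = - l1 * (of_nat i - of_nat j)\<^sup>2 * b $$ (i, j)"
      using ij c by (simp add: cubic_index[where n = n] assoc ax mult_carrier_mat[of _ n n] l3 algebra_simps power2_eq_square
          del: index_mult_mat(1) assoc_mult_mat)
    also have "\<dots> = B $$ (i, j)"
      using ij B(2) l1 by (cases "i = j") (simp_all add: b_def)
    finally show "cubic l1 l2 l3 l1 l2 l3 a b a $$ (i, j) = B $$ (i, j)" .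
  qed (use B c in auto)
  then show "B \<in> cubic_image n l1 l2 l3 l1 l2 l3" using c by (intro cubic_imageI)
qed

text \<open>
  The witnesses are \<open>a = diag(0, 1, \<dots>, n - 1)\<close> and \<open>c = E\<^sub>1\<^sub>0 + \<psi> 1\<close> with 0-based matrix units. The part
  \<open>f(a, b, E\<^sub>1\<^sub>0)\<close> lives in column 0 and row 1, and \<open>f(a, b, \<psi> 1) = \<psi> \<alpha> [a, b]\<close> solves for the remaining
  off-diagonal entries. On the diagonal only \<open>b\<^sub>0\<^sub>1\<close> survives, which dictates the normal form of \<open>A\<close>, and
  the entry \<open>(0, 1)\<close> dictates \<open>\<psi>\<close>.
\<close>
lemma nonscalar_in_cubic_image:
  assumes sum0: "l1 + l2 + l3 + m1 + m2 + m3 = 0" and \<alpha>0: "l1 + l3 + m2 \<noteq> 0"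
    and s: "m1 + m2 + m3 \<noteq> 0"
    and A: "A \<in> carrier_mat n n" "nonscalar A" "mat_trace A \<noteq> 0"
  shows "A \<in> cubic_image n l1 l2 l3 m1 m2 m3"
proof -
  define \<alpha> where "\<alpha> = l1 + l3 + m2"
  \<comment> \<open>The intended value of \<open>b $$ (0, 1)\<close>. It contributes
    \<open>m3 * \<beta>\<close> to entry (0, 0) and \<open>(m1 + m2) * \<beta>\<close> to entry (1,
    1), which must add up to the trace.\<close>
  define \<beta> where "\<beta> = mat_trace A / (m1 + m2 + m3)"
  have \<alpha>: "\<alpha> \<noteq> 0" and \<beta>: "\<beta> \<noteq> 0" using \<alpha>0 s A by (simp_all add: \<alpha>_def \<beta>_def)
  have n: "1 < n"
  proof -
    from A obtain i j where "i < n" "j < n" "i \<noteq> j" by (auto simp: nonscalar_def)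
    then show ?thesis by auto
  qed
  then have n0: "0 < n" by simp
  have "m3 * \<beta> + (m1 + m2) * \<beta> = (m1 + m2 + m3) * \<beta>" by (simp add: algebra_simps)
  also have "\<dots> = mat_trace A" using s by (simp add: \<beta>_def)
  finally have "m3 * \<beta> + (m1 + m2) * \<beta> = mat_trace A" .
  then obtain B P Q where sim: "similar_mat_wit A B P Q" and B00: "B $$ (0, 0) = m3 * \<beta>" and B11: "B $$ (1, 1) = (m1 + m2) * \<beta>"
    and Bii: "\<And>i. i < n \<Longrightarrow> i \<ge> 2 \<Longrightarrow> B $$ (i, i) = 0" and B01: "B $$ (0, 1) \<noteq> 0"
    using nonscalar_prescribe_two_diagonal[OF A(1,2)] by metis
  note Bc = similar_mat_witD2(5)[OF A(1) sim]
  \<comment> \<open>Solves \<open>e 0 1 = \<beta>\<close>.\<close>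
  define \<psi> where "\<psi> = - B $$ (0, 1) / (\<alpha> * \<beta>)"
  have \<psi>: "\<psi> \<noteq> 0" using B01 \<alpha> \<beta> by (simp add: \<psi>_def)
  \<comment> \<open>The corrections in \<open>b\<close> use only its column 1 and row 0. There
    \<open>b\<close> equals \<open>e\<close>, so the definition is not circular; at (0, 0) and (1,
    1) both are 0 because division by zero yields 0.\<close>
  define e where "e i j = B $$ (i, j) / (\<psi> * \<alpha> * (of_nat i - of_nat j))" for i j
  define b where "b = mat n n (\<lambda>(i, j). (B $$ (i, j)
     - (if j = 0 then e i 1 * (l1 * of_nat i + m3) else 0)
     - (if i = 1 then e 0 j * (m1 * of_nat j + m2) else 0)) / (\<psi> * \<alpha> * (of_nat i - of_nat j)))"
  define a where "a = mat_diag n (\<lambda>i. of_nat i :: 'a)"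
  define c where "c = mat n n (\<lambda>(i, j). if i = 1 \<and> j = 0 then 1 else if i = j then \<psi> else 0)"
  have car: "a \<in> carrier_mat n n" "b \<in> carrier_mat n n" "c \<in> carrier_mat n n" by (simp_all add: a_def b_def c_def)
  have ax: "(a * x) $$ (i, j) = of_nat i * x $$ (i, j)" "(x * a) $$ (i, j) = x $$ (i, j) * of_nat j"
    if "i < n" "j < n" "x \<in> carrier_mat n n" for i j x
    using that car by (simp_all add: a_def mat_diag_mult_left[of _ n n] mat_diag_mult_right[of _ n n])
  have cx: "(c * x) $$ (i, j) = (if i = 1 then x $$ (0, j) else 0) + \<psi> * x $$ (i, j)"
    and xc: "(x * c) $$ (i, j) = (if j = 0 then x $$ (i, 1) else 0) + \<psi> * x $$ (i, j)"
    if "i < n" "j < n" "x \<in> carrier_mat n n" for i j x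
  proof -
    have "(c * x) $$ (i, j) = (\<Sum>k<n. (if k = 0 then if i = 1 then x $$ (k, j) else 0 else 0) + (if k = i then \<psi> * x $$ (k, j) else 0))"
      unfolding index_mult_mat_sum[OF car(3) that(3,1,2)] using that n by (intro sum.cong) (auto simp: c_def)
    then show "(c * x) $$ (i, j) = (if i = 1 then x $$ (0, j) else 0) + \<psi> * x $$ (i, j)"
      using that n by (simp add: sum.distrib)
    have "(x * c) $$ (i, j) = (\<Sum>k<n. (if k = 1 then if j = 0 then x $$ (i, k) else 0 else 0) + (if k = j then \<psi> * x $$ (i, k) else 0))"
      unfolding index_mult_mat_sum[OF that(3) car(3) that(1,2)] using that n by (intro sum.cong) (auto simp: c_def)
    then show "(x * c) $$ (i, j) = (if j = 0 then x $$ (i, 1) else 0) + \<psi> * x $$ (i, j)"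
      using that n by (simp add: sum.distrib)
  qed
  have cab: "c * a * b = c * (a * b)" "a * c * b = a * (c * b)" using car by simp_all
  have m1: "m1 = - \<alpha> - l2 - m3" using sum0 by (simp add: \<alpha>_def algebra_simps eq_neg_iff_add_eq_0)
  \<comment> \<open>The matrix unit contributes nothing through l2 and l3, since \<open>a\<close>
    has entry 0 at (0, 0).\<close>
  have idx: "cubic l1 l2 l3 m1 m2 m3 a b c $$ (i, j) =
      (if j = 0 then b $$ (i, 1) * (l1 * of_nat i + m3) else 0)
      + (if i = 1 then b $$ (0, j) * (m1 * of_nat j + m2) else 0)
      + \<psi> * \<alpha> * (of_nat i - of_nat j) * b $$ (i, j)" if "i < n" "j < n" for i j
    using that car n
    by (simp add: cubic_index[where n = n] cab ax cx xc mult_carrier_mat[of _ n n] m1 del: index_mult_mat(1) assoc_mult_mat)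
       (simp add: \<alpha>_def algebra_simps)
  have b_col: "b $$ (i, 1) = e i 1" if "i < n" for i using that n by (simp add: b_def e_def)
  have b_row: "b $$ (0, j) = e 0 j" if "j < n" for j using that n by (simp add: b_def e_def)
  have b01: "b $$ (0, 1) = \<beta>" unfolding b_col[OF n0] using B01 \<alpha> \<beta> by (simp add: e_def \<psi>_def)
  have "cubic l1 l2 l3 m1 m2 m3 a b c = B"
  proof (rule eq_matI)
    fix i j assume "i < dim_row B" "j < dim_col B"
    then have ij: "i < n" "j < n" using Bc by auto
    show "cubic l1 l2 l3 m1 m2 m3 a b c $$ (i, j) = B $$ (i, j)"
    proof (cases "i = j")
      case True
      consider "i = 0" | "i = 1" | "i \<ge> 2" by linarith
      then show ?thesis
        using ij n True B00 B11 Bii b01 by cases (simp_all add: idx algebra_simps del: One_nat_def)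
    next
      case False
      then have "\<psi> * \<alpha> * (of_nat i - of_nat j) \<noteq> 0" using \<psi> \<alpha> by simp
      then have "\<psi> * \<alpha> * (of_nat i - of_nat j) * b $$ (i, j) = B $$ (i, j)
         - (if j = 0 then e i 1 * (l1 * of_nat i + m3) else 0) - (if i = 1 then e 0 j * (m1 * of_nat j + m2) else 0)"
        using ij by (simp add: b_def)
      then show ?thesis using ij by (simp add: idx b_col b_row del: One_nat_def)
    qed
  qed (use Bc car in auto)
  then have "B \<in> cubic_image n l1 l2 l3 m1 m2 m3" using car by (intro cubic_imageI)
  then show ?thesis by (rule cubic_image_similar[OF A(1) sim])
qed

section \<open>Weighted shifts and scalar targets\<close>

definition lower_shift :: "nat \<Rightarrow> (nat \<Rightarrow> 'a::comm_ring_1) \<Rightarrow> 'a mat" where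
  "lower_shift n u = mat n n (\<lambda>(i, j). if i = Suc j then u j else 0)"

definition upper_shift :: "nat \<Rightarrow> (nat \<Rightarrow> 'a::comm_ring_1) \<Rightarrow> 'a mat" where
  "upper_shift n w = mat n n (\<lambda>(i, j). if j = Suc i then w j else 0)"

lemma shift_carrier [simp]: "lower_shift n u \<in> carrier_mat n n" "upper_shift n w \<in> carrier_mat n n"
  by (simp_all add: lower_shift_def upper_shift_def)

text \<open>Both shifts index weights by column, so \<open>w 0\<close> is not an entry; its
  vanishing makes the formula right at i = 0, where the product is 0. The companion lemma uses
  \<open>w n = 0\<close> at the last index likewise.\<close>

lemma lower_upper_shift:
  assumes "w 0 = 0"
  shows "lower_shift n u * upper_shift n w = mat_diag n (\<lambda>i. u (i - 1) * w i)"
proof (rule eq_matI)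
  fix i j assume "i < dim_row (mat_diag n (\<lambda>i. u (i - 1) * w i))" "j < dim_col (mat_diag n (\<lambda>i. u (i - 1) * w i))"
  then have ij: "i < n" "j < n" using mat_diag_dim[of n] by auto
  have "(lower_shift n u * upper_shift n w) $$ (i, j) = (\<Sum>k<n. lower_shift n u $$ (i, k) * upper_shift n w $$ (k, j))"
    using ij by (intro index_mult_mat_sum) auto
  also have "\<dots> = (\<Sum>k<n. if k = i - 1 then if i = j \<and> i > 0 then u k * w j else 0 else 0)"
    using ij by (intro sum.cong) (auto simp: lower_shift_def upper_shift_def)
  also have "\<dots> = mat_diag n (\<lambda>i. u (i - 1) * w i) $$ (i, j)"
    using ij assms by (cases i) (auto simp: mat_diag_def)
  finally show "(lower_shift n u * upper_shift n w) $$ (i, j) = mat_diag n (\<lambda>i. u (i - 1) * w i) $$ (i, j)" .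
qed (use mat_diag_dim[of n] in \<open>auto simp: lower_shift_def upper_shift_def\<close>)

lemma upper_lower_shift:
  assumes "w n = 0"
  shows "upper_shift n w * lower_shift n u = mat_diag n (\<lambda>i. w (Suc i) * u i)"
proof (rule eq_matI)
  fix i j assume "i < dim_row (mat_diag n (\<lambda>i. w (Suc i) * u i))" "j < dim_col (mat_diag n (\<lambda>i. w (Suc i) * u i))"
  then have ij: "i < n" "j < n" using mat_diag_dim[of n] by auto
  have "(upper_shift n w * lower_shift n u) $$ (i, j) = (\<Sum>k<n. upper_shift n w $$ (i, k) * lower_shift n u $$ (k, j))"
    using ij by (intro index_mult_mat_sum) auto
  also have "\<dots> = (\<Sum>k<n. if k = Suc i then if i = j then w k * u j else 0 else 0)"
    using ij by (intro sum.cong) (auto simp: lower_shift_def upper_shift_def)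
  also have "\<dots> = mat_diag n (\<lambda>i. w (Suc i) * u i) $$ (i, j)"
    using ij assms by (cases "Suc i = n") (auto simp: mat_diag_def)
  finally show "(upper_shift n w * lower_shift n u) $$ (i, j) = mat_diag n (\<lambda>i. w (Suc i) * u i) $$ (i, j)" .
qed (use mat_diag_dim[of n] in \<open>auto simp: lower_shift_def upper_shift_def\<close>)

text \<open>
  For opposite weighted shifts \<open>a\<close>, \<open>b\<close> and diagonal \<open>c\<close>, all six monomials are diagonal.
\<close>
lemma scalar_in_cubic_image:
  assumes sum0: "l1 + l2 + l3 + m1 + m2 + m3 = 0" and \<alpha>: "l1 + l3 + m2 \<noteq> 0"
    and s: "l1 + l2 + l3 \<noteq> 0" and n: "n \<ge> 2"
  shows "k \<cdot>\<^sub>m 1\<^sub>m n \<in> cubic_image n l1 l2 l3 m1 m2 m3"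
proof -
  \<comment> \<open>The chain conditions A + B and A + C nonzero become \<open>l1 + l3 + m2\<close>
    and \<open>l1 + l2 + l3\<close> nonzero.\<close>
  have "weight_chain (l1 + l3) m2 l2 (m1 + m3) n"
    using assms by (intro weight_chain_exists) (simp_all add: algebra_simps)
  then obtain c v where v: "v 0 = 0" "v n = 0" "\<And>i. i < n \<Longrightarrow>
      v i * ((l1 + l3) * c i + m2 * c (i - 1)) + v (Suc i) * ((m1 + m3) * c i + l2 * c (Suc i)) = 1"
    unfolding weight_chain_def by blast
  \<comment> \<open>The chain is linear in the weights, so scaling them turns 1 into k.\<close>
  define w where "w i = k * v i" for i
  define a where "a = lower_shift n (\<lambda>_. 1 :: 'a)"
  define b where "b = upper_shift n w"
  define C where "C = mat_diag n c"
  have car: "a \<in> carrier_mat n n" "b \<in> carrier_mat n n" "C \<in> carrier_mat n n" by (simp_all add: a_def b_def C_def)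
  have w: "w 0 = 0" "w n = 0" using v by (simp_all add: w_def)
  have ab: "a * b = mat_diag n w" unfolding a_def b_def by (simp add: lower_upper_shift w)
  have ba: "b * a = mat_diag n (\<lambda>i. w (Suc i))" unfolding a_def b_def by (simp add: upper_lower_shift w)
  have Ca: "C * a = lower_shift n (\<lambda>j. c (Suc j))"
    using car unfolding C_def by (simp add: mat_diag_mult_left[of _ n n]) (auto simp: a_def lower_shift_def intro!: eq_matI)
  have Cb: "C * b = upper_shift n (\<lambda>j. c (j - 1) * w j)"
    using car unfolding C_def by (simp add: mat_diag_mult_left[of _ n n]) (auto simp: b_def upper_shift_def intro!: eq_matI)
  have "b * C * a = mat_diag n (\<lambda>i. w (Suc i) * c (Suc i))"
    using car by (simp add: Ca) (simp add: b_def upper_lower_shift w)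
  moreover have "a * C * b = mat_diag n (\<lambda>i. c (i - 1) * w i)"
    using car by (simp add: Cb) (simp add: a_def lower_upper_shift w)
  moreover have "a * b * C = mat_diag n (\<lambda>i. w i * c i)" "b * a * C = mat_diag n (\<lambda>i. w (Suc i) * c i)"
    by (simp_all add: ab ba C_def)
  moreover have "C * a * b = mat_diag n (\<lambda>i. c i * w i)" "C * b * a = mat_diag n (\<lambda>i. c i * w (Suc i))"
    using car by (simp_all add: ab ba) (simp_all add: C_def)
  ultimately have "cubic l1 l2 l3 m1 m2 m3 a b C = mat_diag n (\<lambda>i. l1 * (w i * c i) + l2 * (w (Suc i) * c (Suc i))
      + l3 * (c i * w i) + m1 * (c i * w (Suc i)) + m2 * (c (i - 1) * w i) + m3 * (w (Suc i) * c i))"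
    unfolding cubic_def by (auto simp: mat_diag_def intro!: eq_matI)
  also have "\<dots> = mat_diag n (\<lambda>i. k * (v i * ((l1 + l3) * c i + m2 * c (i - 1))
      + v (Suc i) * ((m1 + m3) * c i + l2 * c (Suc i))))"
    by (rule arg_cong[of _ _ "mat_diag n"]) (auto simp: w_def algebra_simps)
  also have "\<dots> = k \<cdot>\<^sub>m 1\<^sub>m n"
    by (rule eq_matI) (simp_all add: mat_diag_def v(3) del: One_nat_def)
  finally show ?thesis using car by (intro cubic_imageI)
qed

section \<open>Determination of the image\<close>

lemma zero_in_cubic_image: "0\<^sub>m n n \<in> cubic_image n l1 l2 l3 m1 m2 m3"
  by (rule cubic_imageI[of "0\<^sub>m n n" _ "0\<^sub>m n n" "0\<^sub>m n n"]) (auto simp: cubic_def intro!: eq_matI)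

text \<open>Traceless matrices are always attained, so only the trace can obstruct. It does so when
  matrices commute (n = 1) or both cyclic coefficient sums vanish; otherwise scalar and nonscalar
  targets are treated separately.\<close>

lemma cubic_image_eq_cases:
  assumes sum0: "l1 + l2 + l3 + m1 + m2 + m3 = 0" and \<alpha>: "l1 + l3 + m2 \<noteq> 0" and n: "n > 0"
  shows "cubic_image n l1 l2 l3 m1 m2 m3 \<in> {carrier_mat n n, {A \<in> carrier_mat n n. mat_trace A = 0}}"
proof (cases "n = 1 \<or> l1 + l2 + l3 = 0")
  case True
  have "mat_trace A = 0" if A: "A \<in> cubic_image n l1 l2 l3 m1 m2 m3" for A
  proof -
    obtain a b c where abc: "a \<in> carrier_mat n n" "b \<in> carrier_mat n n" "c \<in> carrier_mat n n"
      and eq: "A = cubic l1 l2 l3 m1 m2 m3 a b c" using A by (auto simp: cubic_image_def)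
    from True show ?thesis
    proof
      assume "l1 + l2 + l3 = 0"
      moreover from this sum0 have "m1 + m2 + m3 = 0" by (simp add: algebra_simps)
      ultimately show ?thesis using abc by (simp add: eq mat_trace_cubic)
    next
      assume n1: "n = 1"
      have "a * c * b = a * b * c"
        using abc n1 by (intro eq_matI) (auto simp: scalar_prod_def)
      then have "mat_trace A = (l1 + l2 + l3 + m1 + m2 + m3) * mat_trace (a * b * c)"
        unfolding eq mat_trace_cubic[OF abc] by (simp only:) (simp add: algebra_simps)
      then show ?thesis using sum0 by simp
    qed
  qed
  then show ?thesis
    using cubic_image_subset traceless_in_cubic_image_commutator[OF sum0 \<alpha> n] by blast
next
  case False
  then have n2: "n \<ge> 2" and s: "l1 + l2 + l3 \<noteq> 0" using n by auto
  have "(l1 + l2 + l3) + (m1 + m2 + m3) = 0" using sum0 by (simp add: add.assoc)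
  with s have t: "m1 + m2 + m3 \<noteq> 0" by (metis add.right_neutral)
  have "A \<in> cubic_image n l1 l2 l3 m1 m2 m3" if A: "A \<in> carrier_mat n n" for A
  proof (cases "nonscalar A")
    case True
    then show ?thesis
      using A traceless_in_cubic_image_commutator[OF sum0 \<alpha> n A] nonscalar_in_cubic_image[OF sum0 \<alpha> t A] by blast
  next
    case False
    then have "A = A $$ (0, 0) \<cdot>\<^sub>m 1\<^sub>m n"
      using A n by (intro eq_matI) (auto simp: nonscalar_def)
    then show ?thesis using scalar_in_cubic_image[OF sum0 \<alpha> s n2] by metis
  qed
  then show ?thesis using cubic_image_subset by blast
qed

lemma cubic_image_Lie_eq:
  assumes sum0: "l1 + l2 + l3 = 0" and "l1 \<noteq> 0" and n: "n > 0"
  shows "cubic_image n l1 l2 l3 l1 l2 l3 = {A \<in> carrier_mat n n. mat_trace A = 0}"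
  using cubic_image_traceless[OF sum0 sum0] traceless_in_cubic_image_Lie[OF assms] by blast

lemma cubic_image_cases:
  assumes n: "n > 0"
  shows "cubic_image n l1 l2 l3 m1 m2 m3 \<in> {{0\<^sub>m n n}, {A \<in> carrier_mat n n. mat_trace A = 0}, carrier_mat n n}"
proof (cases "l1 + l2 + l3 + m1 + m2 + m3 = 0")
  case False
  define s where "s = l1 + l2 + l3 + m1 + m2 + m3"
  have "A \<in> cubic_image n l1 l2 l3 m1 m2 m3" if A: "A \<in> carrier_mat n n" for A
  proof (rule cubic_imageI[of "(1 / s) \<cdot>\<^sub>m A" _ "1\<^sub>m n" "1\<^sub>m n"])
    show "cubic l1 l2 l3 m1 m2 m3 ((1 / s) \<cdot>\<^sub>m A) (1\<^sub>m n) (1\<^sub>m n) = A"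
    proof (rule eq_matI)
      fix i j assume "i < dim_row A" "j < dim_col A"
      then have "cubic l1 l2 l3 m1 m2 m3 ((1 / s) \<cdot>\<^sub>m A) (1\<^sub>m n) (1\<^sub>m n) $$ (i, j) = s * ((1 / s) * A $$ (i, j))"
        using A by (simp add: cubic_index[where n = n] s_def algebra_simps add_divide_distrib del: index_mult_mat(1))
      then show "cubic l1 l2 l3 m1 m2 m3 ((1 / s) \<cdot>\<^sub>m A) (1\<^sub>m n) (1\<^sub>m n) $$ (i, j) = A $$ (i, j)"
        using False by (simp add: s_def)
    qed (use A in auto)
  qed (use A in auto)
  then show ?thesis using cubic_image_subset by blast
next
  case True
  have r1: "cubic_image n l1 l2 l3 m1 m2 m3 = cubic_image n l2 l3 l1 m2 m3 m1" by (rule cubic_image_rotate)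
  have r2: "\<dots> = cubic_image n l3 l1 l2 m3 m1 m2" by (rule cubic_image_rotate)
  \<comment> \<open>These are the coefficients of xy, yz and zx after setting z, x and y
    respectively to 1.\<close>
  consider "l1 + l3 + m2 \<noteq> 0" | "l2 + l1 + m3 \<noteq> 0" | "l3 + l2 + m1 \<noteq> 0"
    | "l1 + l3 + m2 = 0" "l2 + l1 + m3 = 0" "l3 + l2 + m1 = 0" by blast
  then show ?thesis
  proof cases
    case 1
    then show ?thesis using cubic_image_eq_cases[OF True _ n] by blast
  next
    case 2
    have "l2 + l3 + l1 + m2 + m3 + m1 = 0" using True by (simp add: algebra_simps)
    then show ?thesis unfolding r1 using cubic_image_eq_cases[OF _ 2 n] by blast
  next
    case 3
    have "l3 + l1 + l2 + m3 + m1 + m2 = 0" using True by (simp add: algebra_simps)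
    then show ?thesis unfolding r1 r2 using cubic_image_eq_cases[OF _ 3 n] by blast
  next
    case 4
    \<comment> \<open>Adding the three relations to the zero total makes the l sum vanish, whence
      each m equals the corresponding l: the Lie case.\<close>
    have m: "m1 = - l3 - l2" "m2 = - l1 - l3" "m3 = - l2 - l1"
      using 4 by (simp_all add: algebra_simps eq_neg_iff_add_eq_0)
    have "l1 + l2 + l3 + m1 + m2 + m3 = - (l1 + l2 + l3)" unfolding m by (simp add: algebra_simps)
    with True have sums: "l1 + l2 + l3 = 0" by (metis neg_equal_0_iff_equal)
    then have "l3 = - l1 - l2" by (simp add: algebra_simps eq_neg_iff_add_eq_0)
    then have eq: "m1 = l1" "m2 = l2" "m3 = l3" and sums': "l2 + l3 + l1 = 0" "l3 + l1 + l2 = 0"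
      unfolding m by simp_all
    consider "l1 \<noteq> 0" | "l2 \<noteq> 0" | "l3 \<noteq> 0" | "l1 = 0" "l2 = 0" "l3 = 0" by blast
    then show ?thesis
    proof cases
      case 1
      then show ?thesis unfolding eq using cubic_image_Lie_eq[OF sums 1 n] by simp
    next
      case 2
      then show ?thesis unfolding r1 unfolding eq using cubic_image_Lie_eq[OF sums'(1) 2 n] by simp
    next
      case 3
      then show ?thesis unfolding r1 r2 unfolding eq using cubic_image_Lie_eq[OF sums'(2) 3 n] by simp
    next
      case 4
      have "cubic 0 0 0 0 0 0 a b c = 0\<^sub>m n n"
        if "a \<in> carrier_mat n n" "b \<in> carrier_mat n n" "c \<in> carrier_mat n n" for a b c :: "'a mat"
        using that by (auto simp: cubic_def intro!: eq_matI)
      then have "cubic_image n l1 l2 l3 m1 m2 m3 \<subseteq> {0\<^sub>m n n}"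
        unfolding eq 4 by (auto simp: cubic_image_def)
      then show ?thesis using zero_in_cubic_image by blast
    qed
  qed
qed

theorem theorem2:
  fixes f :: "'k::{alg_closed_field, field_char_0} nc_poly"
  assumes "multilinear_deg3 f"
  shows "\<forall>n>0. VectorSpace.subspace class_ring (nc_image n f) (module_mat TYPE('k) n n)"
proof (intro allI impI)
  fix n :: nat assume n: "n > 0"
  obtain l1 l2 l3 m1 m2 m3 where f: "f =
     (let x = nc_var Ind_x; y = nc_var Ind_y; z = nc_var Ind_z in
        nc_const l1 * (x * y * z) + nc_const l2 * (y * z * x) + nc_const l3 * (z * x * y)
          + nc_const m1 * (z * y * x) + nc_const m2 * (x * z * y) + nc_const m3 * (y * x * z))"
    using assms unfolding multilinear_deg3_def Let_def by blast
  have "nc_image n f = cubic_image n l1 l2 l3 m1 m2 m3"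
    unfolding nc_image_def cubic_image_def f using nc_eval_cubic by (metis (no_types, opaque_lifting))
  with cubic_image_cases[OF n] have
    "nc_image n f \<in> {{0\<^sub>m n n}, {A \<in> carrier_mat n n. mat_trace A = 0}, carrier_mat n n}" by metis
  then consider "nc_image n f = {0\<^sub>m n n}" | "nc_image n f = {A \<in> carrier_mat n n. mat_trace A = 0}"
    | "nc_image n f = carrier_mat n n" by blast
  then show "VectorSpace.subspace class_ring (nc_image n f) (module_mat TYPE('k) n n)"
  proof cases
    case 1
    have "c \<cdot>\<^sub>m 0\<^sub>m n n = (0\<^sub>m n n :: 'k mat)" for c by (rule eq_matI) auto
    then show ?thesis unfolding subspace_module_mat_iff 1 by simp
  next
    case 2
    have "mat_trace (0\<^sub>m n n :: 'k mat) = 0" by (simp add: mat_trace_def)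
    then show ?thesis unfolding subspace_module_mat_iff 2 by (auto simp: mat_trace_add[of _ n] mat_trace_smult[of _ n])
  next
    case 3
    then show ?thesis unfolding subspace_module_mat_iff 3 by simp
  qed
qed

end
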